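(* Let $T$ be a phylogenetic tree on $X$ with $|X|\ge 5$. If $T$ is a star, then $T$ has leaf-reconstruction number $3$; otherwise $T$ has leaf-reconstruction number $2$.
   Context: $X$ is a finite set. A phylogenetic tree on $X$ is a tree with no degree-2 vertices whose leaves are bijectively labelled by $X$ (not necessarily binary); it is a star if it has exactly one non-leaf vertex. A blob of a graph is a maximal 2-connected subgraph with at least two edges. A phylogenetic network on $X$ is a connected graph $N$ such that contracting each blob into a single vertex yields a phylogenetic tree on $X$. A pseudo-network on $X$ is a multigraph with no degree-2 vertices whose leaves are bijectively labelled by $X$. Two pseudo-networks are equivalent ($\sim$) if there is a graph isomorphism between them that is the identity on $X$. $N_v$ denotes the pseudo-network obtained from $N$ by deleting vertex $v$ with its incident edges and suppressing resulting degree-2 vertices. For $U\subseteq V(N)$, a $U$-reconstruction of $N$ is a phylogenetic network $N'$ on $X$ with $V(N')=V(N)$ and $N'_u\sim N_u$ for all $u\in U$; $N$ is $U$-reconstructible if every $U$-reconstruction of $N$ is equivalent to $N$. The leaf-reconstruction number of $N$ is the smallest $m$ such that there exists $U'\subseteq X$ with $|U'|=m$ and $N$ is $U'$-reconstructible.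
   Formalization: The condition V(N') = V(N) on a U-reconstruction is dropped and only U ⊆ V(N') is kept; with it a star would be the only network on its vertex set, hence reconstructible from no leaves, with leaf-reconstruction number 0 instead of 3. *)

theory Defs
  imports Main "HOL-Library.Multiset" "HOL-Library.Uprod" "HOL-Library.Infinite_Typeclass"
begin

section \<open>Multigraphs\<close>

text \<open>An edge is an unordered pair of vertices; \<open>Upair v v\<close> is a loop at \<open>v\<close>, and parallel
  edges are recorded by multiplicity.\<close>

record 'v mgraph =
  verts :: "'v set"
  edges :: "'v uprod multiset"

definition wf_mgraph :: "'v mgraph \<Rightarrow> bool" where
  "wf_mgraph G \<longleftrightarrow> finite (verts G) \<and> (\<forall>e \<in># edges G. set_uprod e \<subseteq> verts G)"

definition simple_graph :: "'v mgraph \<Rightarrow> bool" where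
  "simple_graph G \<longleftrightarrow> wf_mgraph G \<and> (\<forall>v. Upair v v \<notin># edges G) \<and> (\<forall>e. count (edges G) e \<le> 1)"

text \<open>A loop contributes 2 to the degree.\<close>

definition degree :: "'v mgraph \<Rightarrow> 'v \<Rightarrow> nat" where
  "degree G v = size {# e \<in># edges G. v \<in> set_uprod e #} + count (edges G) (Upair v v)"

definition leaves :: "'v mgraph \<Rightarrow> 'v set" where
  "leaves G = {v \<in> verts G. degree G v = 1}"

definition adjacent :: "'v mgraph \<Rightarrow> 'v \<Rightarrow> 'v \<Rightarrow> bool" where
  "adjacent G u v \<longleftrightarrow> Upair u v \<in># edges G"

definition connected_graph :: "'v mgraph \<Rightarrow> bool" where
  "connected_graph G \<longleftrightarrow>
     verts G \<noteq> {} \<and> (\<forall>u \<in> verts G. \<forall>v \<in> verts G. (adjacent G)\<^sup>*\<^sup>* u v)"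

text \<open>A cycle is given by its distinct vertices in cyclic order. Its edges form a submultiset of
  the edges of the graph, so a list of length 1 is a loop and one of length 2 is a pair of parallel
  edges.\<close>

definition is_cycle :: "'v mgraph \<Rightarrow> 'v list \<Rightarrow> bool" where
  "is_cycle G p \<longleftrightarrow> p \<noteq> [] \<and> distinct p \<and> set p \<subseteq> verts G \<and>
     mset (map2 Upair p (rotate1 p)) \<subseteq># edges G"

definition tree :: "'v mgraph \<Rightarrow> bool" where
  "tree G \<longleftrightarrow> wf_mgraph G \<and> connected_graph G \<and> (\<nexists>p. is_cycle G p)"

definition subgraph :: "'v mgraph \<Rightarrow> 'v mgraph \<Rightarrow> bool" where
  "subgraph H G \<longleftrightarrow> wf_mgraph H \<and> verts H \<subseteq> verts G \<and> edges H \<subseteq># edges G"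

definition delete_vertex :: "'v mgraph \<Rightarrow> 'v \<Rightarrow> 'v mgraph" where
  "delete_vertex G v =
     \<lparr>verts = verts G - {v}, edges = {# e \<in># edges G. v \<notin> set_uprod e #}\<rparr>"


section \<open>Blobs and their contraction\<close>

text \<open>2-connected means connected without a cut vertex. A single edge qualifies; it is excluded
  from the blobs by the condition on the number of edges.\<close>

definition two_connected :: "'v mgraph \<Rightarrow> bool" where
  "two_connected G \<longleftrightarrow> connected_graph G \<and> (\<forall>v \<in> verts G. connected_graph (delete_vertex G v))"

definition blob :: "'v mgraph \<Rightarrow> 'v mgraph \<Rightarrow> bool" where
  "blob G B \<longleftrightarrow> subgraph B G \<and> two_connected B \<and> 2 \<le> size (edges B) \<and>
     (\<forall>B'. subgraph B' G \<and> two_connected B' \<and> subgraph B B' \<longrightarrow> B' = B)"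

definition same_blob :: "'v mgraph \<Rightarrow> 'v \<Rightarrow> 'v \<Rightarrow> bool" where
  "same_blob G u v \<longleftrightarrow> (\<exists>B. blob G B \<and> u \<in> verts B \<and> v \<in> verts B)"

text \<open>The vertices of the contracted graph are the sets of vertices of \<open>G\<close> that are merged. The
  transitive closure is needed because distinct blobs can share a cut vertex. A vertex \<open>v\<close> that
  lies in no blob becomes \<open>{v}\<close>.\<close>

definition blob_class :: "'v mgraph \<Rightarrow> 'v \<Rightarrow> 'v set" where
  "blob_class G v = {u. (same_blob G)\<^sup>*\<^sup>* v u}"

definition contract_blobs :: "'v mgraph \<Rightarrow> 'v set mgraph" where
  "contract_blobs G =
     \<lparr>verts = blob_class G ` verts G,
      edges = image_mset (map_uprod (blob_class G))
                {# e \<in># edges G. \<nexists>B. blob G B \<and> e \<in># edges B #}\<rparr>"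


section \<open>Phylogenetic trees and networks\<close>

definition labelled_phylo_tree :: "('x \<Rightarrow> 'v) \<Rightarrow> 'x set \<Rightarrow> 'v mgraph \<Rightarrow> bool" where
  "labelled_phylo_tree l X T \<longleftrightarrow>
     tree T \<and> (\<forall>v \<in> verts T. degree T v \<noteq> 2) \<and> bij_betw l X (leaves T)"

text \<open>Leaves are identified with their labels, so that \<open>X\<close> is a set of vertices. In the contraction
  of a network the leaf labelled \<open>x\<close> is the uncontracted vertex \<open>{x}\<close>.\<close>

definition phylogenetic_tree :: "'v set \<Rightarrow> 'v mgraph \<Rightarrow> bool" where
  "phylogenetic_tree X T \<longleftrightarrow> labelled_phylo_tree (\<lambda>x. x) X T"

definition star :: "'v mgraph \<Rightarrow> bool" where
  "star T \<longleftrightarrow> (\<exists>!v. v \<in> verts T \<and> v \<notin> leaves T)"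

definition phylogenetic_network :: "'v set \<Rightarrow> 'v mgraph \<Rightarrow> bool" where
  "phylogenetic_network X N \<longleftrightarrow>
     simple_graph N \<and> connected_graph N \<and> labelled_phylo_tree (\<lambda>x. {x}) X (contract_blobs N)"

definition equivalent :: "'v set \<Rightarrow> 'v mgraph \<Rightarrow> 'v mgraph \<Rightarrow> bool" where
  "equivalent X G H \<longleftrightarrow>
     (\<exists>f. bij_betw f (verts G) (verts H) \<and> image_mset (map_uprod f) (edges G) = edges H \<and>
          (\<forall>x \<in> X. f x = x))"


section \<open>Deleting a vertex and suppressing degree-2 vertices\<close>

text \<open>If the two neighbours \<open>a\<close> and \<open>b\<close> coincide, two parallel edges are replaced by a loop. A
  degree-2 vertex that carries a loop is an isolated loop and cannot be suppressed.\<close>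

inductive suppress_step :: "'v mgraph \<Rightarrow> 'v mgraph \<Rightarrow> bool" where
  "v \<in> verts G \<Longrightarrow> degree G v = 2 \<Longrightarrow> a \<noteq> v \<Longrightarrow> b \<noteq> v \<Longrightarrow>
   {# Upair v a, Upair v b #} \<subseteq># edges G \<Longrightarrow>
   suppress_step G
     \<lparr>verts = verts G - {v},
      edges = edges G - {# Upair v a, Upair v b #} + {# Upair a b #}\<rparr>"

text \<open>The outcome of suppressing as long as possible does not depend on the order, up to an
  isomorphism that fixes all vertices of degree other than 2; the choice below is therefore
  immaterial up to \<^const>\<open>equivalent\<close>.\<close>

definition suppress :: "'v mgraph \<Rightarrow> 'v mgraph" where
  "suppress G = (SOME H. suppress_step\<^sup>*\<^sup>* G H \<and> (\<nexists>H'. suppress_step H H'))"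

lemma suppress_exists:
  assumes "finite (verts G)"
  shows "\<exists>H. suppress_step\<^sup>*\<^sup>* G H \<and> (\<nexists>H'. suppress_step H H')"
  using assms
proof (induction "card (verts G)" arbitrary: G rule: less_induct)
  case less
  show ?case
  proof (cases "\<exists>H. suppress_step G H")
    case True
    then obtain H where H: "suppress_step G H" by blast
    then obtain v where v: "v \<in> verts G" "verts H = verts G - {v}"
      by (auto elim: suppress_step.cases)
    then have "finite (verts H)" and "card (verts H) < card (verts G)"
      using less.prems by (simp, metis card_Diff1_less)
    then show ?thesis
      using less.hyps[of H] H by (meson converse_rtranclp_into_rtranclp)
  qed blast
qed

definition vertex_deleted :: "'v mgraph \<Rightarrow> 'v \<Rightarrow> 'v mgraph" where
  "vertex_deleted N v = suppress (delete_vertex N v)"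


section \<open>Reconstructibility\<close>

text \<open>A reconstruction of \<open>N\<close> may have a different number of interior vertices. Requiring equal vertex
  sets would make every star trivially reconstructible from no leaf at all, because the star is the
  only network on \<open>X\<close> with \<open>card X + 1\<close> vertices. The only condition on the vertices is that
  those of \<open>U\<close> are present, which is automatic for \<open>U \<subseteq> X\<close>.\<close>

definition U_reconstruction :: "'v set \<Rightarrow> 'v set \<Rightarrow> 'v mgraph \<Rightarrow> 'v mgraph \<Rightarrow> bool" where
  "U_reconstruction X U N N' \<longleftrightarrow>
     phylogenetic_network X N' \<and> U \<subseteq> verts N' \<and>
     (\<forall>u \<in> U. equivalent (X - {u}) (vertex_deleted N' u) (vertex_deleted N u))"

definition U_reconstructible :: "'v set \<Rightarrow> 'v set \<Rightarrow> 'v mgraph \<Rightarrow> bool" where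
  "U_reconstructible X U N \<longleftrightarrow> (\<forall>N'. U_reconstruction X U N N' \<longrightarrow> equivalent X N' N)"

definition leaf_reconstruction_number :: "'v set \<Rightarrow> 'v mgraph \<Rightarrow> nat" where
  "leaf_reconstruction_number X N =
     (LEAST m. \<exists>U' \<subseteq> X. card U' = m \<and> U_reconstructible X U' N)"

end

theory Submission
  imports Defs
begin

text \<open>
  Deleting a leaf and suppressing a vertex lower the numbers of vertices and of edges by the same
  amount, so a network with a vertex-deleted graph that is a tree is itself a tree. It then remains
  to compare trees \<open>N\<close> and \<open>T\<close> on \<open>X\<close>, and this is done locally, through the neighbours of leaves
  and their degrees.

  If \<open>T\<close> is not a star, there are distinct interior vertices \<open>p\<close> and \<open>q\<close> that have at most one interior
  neighbour; let \<open>x, x'\<close> and \<open>y, y'\<close> be leaves at \<open>p\<close> and \<open>q\<close>. The deletion of \<open>y\<close> shows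
  that \<open>x\<close> and \<open>x'\<close> have a common neighbour in \<open>N\<close>, of degree 3 iff \<open>p\<close> has degree 3: every way in
  which \<open>y\<close> could obscure this leaves room for only four leaves or contradicts the deletion of
  \<open>x\<close>. Since the position of \<open>x\<close> relative to \<open>x'\<close> is now known, an isomorphism
  between the trees without \<open>x\<close> extends to \<open>N\<close> and \<open>T\<close>. For a star, one of any three deleted leaves
  is attached to a vertex of degree at least 4, and the same extension works.

  Conversely, re-attaching \<open>x\<close> to the pendant edge of another leaf \<open>y\<close> does not change the
  deletion of \<open>x\<close>, nor, if \<open>T\<close> is a star, that of \<open>y\<close>.
\<close>

section \<open>Degrees and adjacency\<close>

definition edge_degree :: "'v uprod multiset \<Rightarrow> 'v \<Rightarrow> nat" where
  "edge_degree M v = size {#e \<in># M. v \<in> set_uprod e#} + count M (Upair v v)"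

lemma degree_eq_edge_degree: "degree G v = edge_degree (edges G) v"
  by (simp add: degree_def edge_degree_def)

lemma edge_degree_union [simp]: "edge_degree (M + N) v = edge_degree M v + edge_degree N v"
  by (simp add: edge_degree_def)

lemma edge_degree_empty [simp]: "edge_degree {#} v = 0"
  by (simp add: edge_degree_def)

lemma edge_degree_add_mset [simp]:
  "edge_degree (add_mset (Upair a b) M) v =
     (if a = v then 1 else 0) + (if b = v then 1 else 0) + edge_degree M v"
  by (auto simp: edge_degree_def Upair_inject)

lemma edge_degree_eq_0: "(\<And>e. e \<in># M \<Longrightarrow> v \<notin> set_uprod e) \<Longrightarrow> edge_degree M v = 0"
proof -
  assume v: "\<And>e. e \<in># M \<Longrightarrow> v \<notin> set_uprod e"
  then have "{#e \<in># M. v \<in> set_uprod e#} = {#}" by simp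
  moreover have "Upair v v \<notin># M" using v[of "Upair v v"] by auto
  ultimately show ?thesis by (simp add: edge_degree_def not_in_iff)
qed

lemma adjacent_sym: "adjacent G u v \<longleftrightarrow> adjacent G v u"
  by (simp add: adjacent_def) (metis Upair_inject)

lemma wf_adjacent_verts:
  assumes "wf_mgraph G" "adjacent G u v"
  shows "u \<in> verts G" "v \<in> verts G"
  using assms by (fastforce simp: wf_mgraph_def adjacent_def)+

lemma uprod_with_member: "v \<in> set_uprod e \<Longrightarrow> \<exists>u. e = Upair v u"
proof (cases e)
  case (Upair a b)
  assume "v \<in> set_uprod e"
  then have "e = Upair v a \<or> e = Upair v b" using Upair by auto
  then show ?thesis by blast
qed

lemma adjacent_rtranclp_sym:
  assumes "(adjacent G)\<^sup>*\<^sup>* u v"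
  shows "(adjacent G)\<^sup>*\<^sup>* v u"
  using assms
  by (induction rule: rtranclp_induct)
    (blast intro: converse_rtranclp_into_rtranclp adjacent_sym[THEN iffD1])+

lemma connected_graphI_root:
  assumes "r \<in> verts G" "\<And>v. v \<in> verts G \<Longrightarrow> (adjacent G)\<^sup>*\<^sup>* r v"
  shows "connected_graph G"
  unfolding connected_graph_def using assms by (blast intro: rtranclp_trans adjacent_rtranclp_sym)

lemma rtranclp_adjacent_map:
  assumes "(adjacent G)\<^sup>*\<^sup>* u v"
    and "\<And>s t. adjacent G s t \<Longrightarrow> (adjacent H)\<^sup>*\<^sup>* (\<pi> s) (\<pi> t)"
  shows "(adjacent H)\<^sup>*\<^sup>* (\<pi> u) (\<pi> v)"
  using assms(1) by (induction rule: rtranclp_induct) (auto intro: rtranclp_trans assms(2))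

lemma connected_graph_map:
  assumes "connected_graph G" "verts H = \<pi> ` verts G"
    and "\<And>s t. adjacent G s t \<Longrightarrow> (adjacent H)\<^sup>*\<^sup>* (\<pi> s) (\<pi> t)"
  shows "connected_graph H"
proof -
  have "(adjacent H)\<^sup>*\<^sup>* (\<pi> u) (\<pi> v)" if "u \<in> verts G" "v \<in> verts G" for u v
    using rtranclp_adjacent_map[of G u v H \<pi>] assms(1,3) that by (simp add: connected_graph_def)
  then show ?thesis using assms(1,2) by (simp add: connected_graph_def)
qed

lemma connected_closed_set:
  assumes "connected_graph G" "w \<in> W" "w \<in> verts G"
    and closed: "\<And>u v. u \<in> W \<Longrightarrow> adjacent G u v \<Longrightarrow> v \<in> W"
  shows "verts G \<subseteq> W"
proof
  fix v assume "v \<in> verts G"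
  then have "(adjacent G)\<^sup>*\<^sup>* w v" using assms by (auto simp: connected_graph_def)
  then show "v \<in> W" by (induction rule: rtranclp_induct) (auto intro: closed assms)
qed


section \<open>Trees and their number of edges\<close>

lemma is_cycle_subgraph:
  assumes "verts H \<subseteq> verts G" "edges H \<subseteq># edges G" "is_cycle H p"
  shows "is_cycle G p"
  using assms by (auto simp: is_cycle_def intro: subset_mset.order_trans)

lemma acyclic_no_loop:
  assumes "wf_mgraph G" "\<nexists>p. is_cycle G p"
  shows "\<not> adjacent G v v"
proof
  assume "adjacent G v v"
  then have "is_cycle G [v]"
    using wf_adjacent_verts[OF assms(1)] by (auto simp: is_cycle_def adjacent_def)
  then show False using assms by blast
qed

lemma acyclic_count_le_1:
  assumes "wf_mgraph G" "\<nexists>p. is_cycle G p"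
  shows "count (edges G) e \<le> 1"
proof (rule ccontr)
  assume c: "\<not> ?thesis"
  obtain u v where e: "e = Upair u v" by (cases e)
  have "adjacent G u v" using c e unfolding adjacent_def by (metis not_in_iff zero_le_one)
  then have "u \<in> verts G" "v \<in> verts G" "u \<noteq> v"
    using wf_adjacent_verts[OF assms(1)] acyclic_no_loop[OF assms] by auto
  moreover have "{#e, e#} \<subseteq># edges G" using c unfolding subseteq_mset_def by auto
  moreover have "mset (map2 Upair [u, v] (rotate1 [u, v])) = {#e, e#}" using e by simp
  ultimately have "is_cycle G [u, v]" unfolding is_cycle_def by simp
  then show False using assms by blast
qed

lemma tree_simple: "tree G \<Longrightarrow> simple_graph G"
  using acyclic_no_loop[of G] acyclic_count_le_1[of G]
  unfolding tree_def simple_graph_def adjacent_def by simp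

lemma is_cycleI:
  assumes "distinct p" "3 \<le> length p" "set p \<subseteq> verts G"
    and "successively (adjacent G) p" "adjacent G (hd p) (last p)"
  shows "is_cycle G p"
proof -
  let ?n = "length p" and ?es = "map2 Upair p (rotate1 p)"
  have nth: "?es ! i = Upair (p ! i) (p ! (Suc i mod ?n))" if "i < ?n" for i
    using that by (simp add: nth_rotate1)
  have dist: "distinct ?es"
  proof (subst distinct_conv_nth, intro allI impI)
    fix i j assume ij: "i < length ?es" "j < length ?es" "i \<noteq> j"
    then have ij': "i < ?n" "j < ?n" by simp_all
    show "?es ! i \<noteq> ?es ! j"
    proof
      assume "?es ! i = ?es ! j"
      then have "p ! i = p ! (Suc j mod ?n)" "p ! j = p ! (Suc i mod ?n)"
        using nth[OF ij'(1)] nth[OF ij'(2)] ij ij' assms(1)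
        by (auto simp: Upair_inject nth_eq_iff_index_eq)
      moreover have "Suc j mod ?n < ?n" "Suc i mod ?n < ?n" using assms(2) by (auto intro: mod_less_divisor)
      ultimately have "i = Suc j mod ?n" "j = Suc i mod ?n"
        using assms(1) ij' by (auto simp: nth_eq_iff_index_eq)
      moreover have "Suc k mod ?n = (if Suc k = ?n then 0 else Suc k)" if "k < ?n" for k
        using that by (simp add: mod_Suc)
      ultimately have "i = 0 \<and> Suc j = ?n \<or> i = Suc j" "j = 0 \<and> Suc i = ?n \<or> j = Suc i"
        using ij' by metis+
      then show False using assms(2) by (elim disjE conjE) linarith+
    qed
  qed
  have "set ?es \<subseteq> set_mset (edges G)"
  proof
    fix e assume "e \<in> set ?es"
    then obtain i where i: "i < ?n" "e = ?es ! i" by (auto simp: in_set_conv_nth)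
    have "adjacent G (p ! i) (p ! (Suc i mod ?n))"
    proof (cases "Suc i = ?n")
      case True
      then have "p ! i = last p" using i by (metis diff_Suc_1 last_conv_nth length_0_conv not_less0)
      moreover have "p ! 0 = hd p" using i by (cases p) auto
      ultimately show ?thesis using assms(5) True by (simp add: adjacent_sym)
    next
      case False
      then show ?thesis using assms(4) i by (simp add: successively_conv_nth)
    qed
    then show "e \<in> set_mset (edges G)" using i(2) nth[OF i(1)] unfolding adjacent_def by metis
  qed
  then have "mset_set (set ?es) \<subseteq># mset_set (set_mset (edges G))"
    by (intro subset_imp_msubset_mset_set) auto
  then have "mset_set (set ?es) \<subseteq># edges G"
    using mset_set_set_mset_msubset subset_mset.order_trans by blast
  then have "mset ?es \<subseteq># edges G"
    using mset_set_set[OF dist] by metis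
  moreover have "p \<noteq> []" using assms(2) by auto
  ultimately show ?thesis using assms(1,3) unfolding is_cycle_def by blast
qed

lemma acyclic_pendant_vertex:
  assumes G: "wf_mgraph G" "\<nexists>p. is_cycle G p" and "I \<subseteq> verts G"
    and v: "v \<in> I" "v' \<in> I" "adjacent G v v'"
  shows "\<exists>u\<in>I. u \<noteq> v \<and> (\<exists>w\<in>I. adjacent G u w \<and> (\<forall>z\<in>I. adjacent G u z \<longrightarrow> z = w))"
proof -
  define P where "P ps \<longleftrightarrow> distinct ps \<and> set ps \<subseteq> I \<and> ps \<noteq> [] \<and> last ps = v \<and>
    successively (adjacent G) ps" for ps
  have finI: "finite I" using assms finite_subset by (auto simp: wf_mgraph_def)
  have P2: "P [v', v]" using v acyclic_no_loop[OF G] by (auto simp: P_def adjacent_sym)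
  have "\<forall>ps. P ps \<longrightarrow> length ps < Suc (card I)"
    unfolding less_Suc_eq_le using finI card_mono distinct_card unfolding P_def by metis
  then obtain ps where ps: "P ps" and max: "\<And>qs. P qs \<Longrightarrow> length qs \<le> length ps"
    using ex_has_greatest_nat[of P "[v', v]" length "Suc (card I)"] P2 by metis
  have "2 \<le> length ps" using max[OF P2] by simp
  then obtain u w qs where eq: "ps = u # w # qs" by (metis Suc_le_length_iff numeral_2_eq_2)
  have "v \<in> set (w # qs)" using ps eq unfolding P_def by (metis last_ConsR last_in_set list.simps(3))
  then have u: "u \<in> I" "w \<in> I" "u \<noteq> v" "adjacent G u w" using ps eq unfolding P_def by auto
  moreover have "z = w" if z: "z \<in> I" "adjacent G u z" for z
  proof (rule ccontr)
    assume "z \<noteq> w"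
    have "z \<in> set ps"
    proof (rule ccontr)
      assume "z \<notin> set ps"
      then have "P (z # ps)" using ps z eq by (auto simp: P_def adjacent_sym)
      then show False using max by fastforce
    qed
    moreover have "z \<noteq> u" using z acyclic_no_loop[OF G] by auto
    ultimately have "z \<in> set qs" using eq \<open>z \<noteq> w\<close> by auto
    then obtain as bs where qs: "qs = as @ z # bs" by (meson split_list)
    let ?c = "u # w # as @ [z]"
    have "is_cycle G ?c"
    proof (rule is_cycleI)
      show "distinct ?c" "set ?c \<subseteq> verts G" using ps eq qs assms by (auto simp: P_def)
      have "successively (adjacent G) (?c @ bs)" using ps eq qs by (simp add: P_def)
      then show "successively (adjacent G) ?c" by (simp only: successively_append_iff)
    qed (use z in auto)
    then show False using G by blast
  qed
  ultimately show ?thesis by blast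
qed


lemma connected_size_edges:
  assumes "wf_mgraph G" "connected_graph G" "S \<subseteq> verts G" "S \<noteq> {}"
  shows "size {#e \<in># edges G. set_uprod e \<subseteq> S#} + card (verts G - S) \<le> size (edges G)"
  using assms(3,4)
proof (induction "card (verts G - S)" arbitrary: S)
  case 0
  then show ?case by (metis add_0_right size_filter_mset_lesseq)
next
  case (Suc n)
  have fin: "finite (verts G)" using assms(1) by (simp add: wf_mgraph_def)
  have "\<not> verts G \<subseteq> S" using Suc.hyps(2) by (metis Diff_eq_empty_iff card.empty nat.distinct(1))
  moreover obtain s0 where "s0 \<in> S" "s0 \<in> verts G" using Suc.prems by blast
  ultimately obtain s t where st: "s \<in> S" "adjacent G s t" "t \<notin> S"
    using connected_closed_set[OF assms(2)] by metis
  have t: "t \<in> verts G" using wf_adjacent_verts[OF assms(1) st(2)] by simp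
  have eq: "verts G - S = insert t (verts G - insert t S)" using t st by auto
  have card: "card (verts G - S) = Suc (card (verts G - insert t S))"
    by (subst eq) (use fin in auto)
  have "size {#e \<in># edges G. set_uprod e \<subseteq> insert t S#} + card (verts G - insert t S)
      \<le> size (edges G)"
    by (rule Suc.hyps(1)) (use card Suc t in auto)
  moreover have "{#e \<in># edges G. set_uprod e \<subseteq> S#} \<subset># {#e \<in># edges G. set_uprod e \<subseteq> insert t S#}"
  proof (rule subset_mset.le_neq_trans)
    show "{#e \<in># edges G. set_uprod e \<subseteq> S#} \<subseteq># {#e \<in># edges G. set_uprod e \<subseteq> insert t S#}"
      by (rule filter_mset_mono_strong) auto
    have "Upair s t \<in># {#e \<in># edges G. set_uprod e \<subseteq> insert t S#}"
      "Upair s t \<notin># {#e \<in># edges G. set_uprod e \<subseteq> S#}"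
      using st by (auto simp: adjacent_def)
    then show "{#e \<in># edges G. set_uprod e \<subseteq> S#} \<noteq> {#e \<in># edges G. set_uprod e \<subseteq> insert t S#}"
      by metis
  qed
  ultimately show ?case using card mset_subset_size by fastforce
qed

lemma connected_acyclicI:
  assumes "wf_mgraph G" "connected_graph G" "size (edges G) + 1 = card (verts G)"
  shows "\<nexists>p. is_cycle G p"
proof
  assume "\<exists>p. is_cycle G p"
  then obtain p where p: "p \<noteq> []" "distinct p" "set p \<subseteq> verts G"
    "mset (map2 Upair p (rotate1 p)) \<subseteq># edges G"
    unfolding is_cycle_def by blast
  have "set_uprod e \<subseteq> set p" if e: "e \<in># mset (map2 Upair p (rotate1 p))" for e
  proof -
    obtain x where x: "x \<in> set (zip p (rotate1 p))" "e = case_prod Upair x"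
      using e unfolding set_mset_mset set_map by blast
    obtain a b where "x = (a, b)" by fastforce
    with x have ab: "(a, b) \<in> set (zip p (rotate1 p))" "e = Upair a b" by simp_all
    then have "a \<in> set p" "b \<in> set (rotate1 p)"
      using set_zip_leftD[OF ab(1)] set_zip_rightD[OF ab(1)] by auto
    then show ?thesis using ab by simp
  qed
  then have "{#e \<in># mset (map2 Upair p (rotate1 p)). set_uprod e \<subseteq> set p#} = mset (map2 Upair p (rotate1 p))"
    by (simp only: filter_mset_eq_conv) auto
  then have "mset (map2 Upair p (rotate1 p)) \<subseteq># {#e \<in># edges G. set_uprod e \<subseteq> set p#}"
    using multiset_filter_mono[OF p(4), of "\<lambda>e. set_uprod e \<subseteq> set p"] by metis
  then have "length p \<le> size {#e \<in># edges G. set_uprod e \<subseteq> set p#}"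
    by (drule_tac size_mset_mono) simp
  moreover have "card (verts G - set p) = card (verts G) - length p"
    using p by (simp add: card_Diff_subset distinct_card)
  moreover have "length p \<le> card (verts G)"
    using p assms(1) by (metis card_mono distinct_card wf_mgraph_def)
  ultimately show False
    using connected_size_edges[OF assms(1,2) p(3)] p(1) assms(3) by simp
qed

lemma treeI_size:
  assumes "wf_mgraph G" "connected_graph G" "size (edges G) + 1 = card (verts G)"
  shows "tree G"
  using assms connected_acyclicI by (simp add: tree_def)

lemma wf_delete_vertex: "wf_mgraph G \<Longrightarrow> wf_mgraph (delete_vertex G v)"
  by (auto simp: wf_mgraph_def delete_vertex_def)

lemma adjacent_delete_vertex:
  "adjacent (delete_vertex G v) s t \<longleftrightarrow> adjacent G s t \<and> s \<noteq> v \<and> t \<noteq> v"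
  by (auto simp: adjacent_def delete_vertex_def)

lemma verts_delete_vertex [simp]: "verts (delete_vertex G v) = verts G - {v}"
  by (simp add: delete_vertex_def)

lemma edges_delete_vertex: "edges (delete_vertex G v) = {#e \<in># edges G. v \<notin> set_uprod e#}"
  by (simp add: delete_vertex_def)

lemma connected_delete_pendant:
  assumes "connected_graph G" "w \<in> verts G" "w \<noteq> u"
    and pendant: "\<And>z. adjacent G u z \<Longrightarrow> z = w"
  shows "connected_graph (delete_vertex G u)"
proof (rule connected_graph_map[OF assms(1), where \<pi> = "\<lambda>v. if v = u then w else v"])
  fix s t assume st: "adjacent G s t"
  then show "(adjacent (delete_vertex G u))\<^sup>*\<^sup>* (if s = u then w else s) (if t = u then w else t)"
    using pendant[of s] pendant[of t] adjacent_sym[of G s t] assms(3)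
    by (auto simp: adjacent_delete_vertex)
qed (use assms in auto)

lemma pendant_edges:
  assumes "simple_graph G" "adjacent G u w" "\<And>z. adjacent G u z \<Longrightarrow> z = w"
  shows "edges G = add_mset (Upair u w) {#e \<in># edges G. u \<notin> set_uprod e#}"
proof -
  have "count {#e \<in># edges G. u \<in> set_uprod e#} e = count {#Upair u w#} e" for e
  proof (cases "e = Upair u w")
    case True
    have "count (edges G) e \<le> 1" "e \<in># edges G"
      using assms(1,2) True by (auto simp: simple_graph_def adjacent_def)
    then have "count (edges G) e = 1" by (metis count_greater_zero_iff le_antisym less_eq_Suc_le One_nat_def)
    then show ?thesis using True by simp
  next
    case False
    have "u \<notin> set_uprod e" if "e \<in># edges G"
    proof
      assume "u \<in> set_uprod e"
      then obtain z where "e = Upair u z" using uprod_with_member by metis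
      then show False using that assms(3)[of z] False by (simp add: adjacent_def)
    qed
    then show ?thesis using False by (auto simp: count_eq_zero_iff)
  qed
  then have "{#e \<in># edges G. u \<in> set_uprod e#} = {#Upair u w#}" by (rule multiset_eqI)
  then show ?thesis using multiset_partition[of "edges G" "\<lambda>e. u \<in> set_uprod e"] by simp
qed

lemma tree_size:
  assumes "tree G"
  shows "size (edges G) + 1 = card (verts G)"
  using assms
proof (induction "card (verts G)" arbitrary: G)
  case 0
  then show ?case by (auto simp: tree_def connected_graph_def wf_mgraph_def)
next
  case (Suc n)
  have wf: "wf_mgraph G" and con: "connected_graph G" and acyc: "\<nexists>p. is_cycle G p"
    using Suc.prems by (auto simp: tree_def)
  then have fin: "finite (verts G)" by (simp add: wf_mgraph_def)
  show ?case
  proof (cases "edges G = {#}")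
    case True
    then have "\<not> adjacent G u v" for u v by (simp add: adjacent_def)
    moreover obtain v where v: "v \<in> verts G" using con by (auto simp: connected_graph_def)
    ultimately have "verts G \<subseteq> {v}" using connected_closed_set[OF con, of v "{v}"] by blast
    then have "verts G = {v}" using v by auto
    then show ?thesis using True by simp
  next
    case False
    then obtain e where "e \<in># edges G" by blast
    moreover obtain v v' where "e = Upair v v'" by (cases e)
    ultimately have v: "adjacent G v v'" by (simp add: adjacent_def)
    obtain u w where u: "u \<in> verts G" "w \<in> verts G" "adjacent G u w"
      and pendant: "\<forall>z\<in>verts G. adjacent G u z \<longrightarrow> z = w"
      using acyclic_pendant_vertex[OF wf acyc order_refl wf_adjacent_verts[OF wf v] v] by blast
    then have u4: "z = w" if "adjacent G u z" for z
      using that wf_adjacent_verts[OF wf that] by blast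
    have "w \<noteq> u" using u acyclic_no_loop[OF wf acyc] by auto
    let ?H = "delete_vertex G u"
    have "is_cycle G p" if "is_cycle ?H p" for p
      by (rule is_cycle_subgraph[OF _ _ that]) (auto simp: edges_delete_vertex)
    then have "tree ?H"
      using wf_delete_vertex[OF wf] connected_delete_pendant[OF con u(2) \<open>w \<noteq> u\<close> u4] acyc
      by (auto simp: tree_def)
    moreover have "n = card (verts ?H)" using Suc.hyps(2) u fin by simp
    ultimately have "size (edges ?H) + 1 = card (verts ?H)" using Suc.hyps(1) by blast
    moreover have "size (edges G) = Suc (size (edges ?H))"
      using arg_cong[OF pendant_edges[OF tree_simple[OF Suc.prems] u(3) u4], of size]
      by (simp add: edges_delete_vertex)
    ultimately show ?thesis using u fin Suc.hyps(2) \<open>n = card (verts ?H)\<close> by simp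
  qed
qed


section \<open>Isomorphisms\<close>

definition graph_iso :: "('a \<Rightarrow> 'b) \<Rightarrow> 'a mgraph \<Rightarrow> 'b mgraph \<Rightarrow> bool" where
  "graph_iso f G H \<longleftrightarrow> bij_betw f (verts G) (verts H) \<and> image_mset (map_uprod f) (edges G) = edges H"

lemma equivalent_iff_graph_iso: "equivalent X G H \<longleftrightarrow> (\<exists>f. graph_iso f G H \<and> (\<forall>x\<in>X. f x = x))"
  unfolding equivalent_def graph_iso_def by (simp only: conj_assoc)

lemma equivalent_refl: "equivalent X G G"
proof -
  have "graph_iso id G G" by (simp add: graph_iso_def uprod.map_id0)
  then show ?thesis unfolding equivalent_iff_graph_iso by fastforce
qed

lemma edge_degree_image_mset:
  assumes "inj_on f V" "v \<in> V" and M: "\<And>e. e \<in># M \<Longrightarrow> set_uprod e \<subseteq> V"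
  shows "edge_degree (image_mset (map_uprod f) M) (f v) = edge_degree M v"
  using M
proof (induction M)
  case (add e M)
  obtain a b where e: "e = Upair a b" by (cases e)
  then have "a \<in> V" "b \<in> V" using add.prems[of e] by auto
  then have "f a = f v \<longleftrightarrow> a = v" "f b = f v \<longleftrightarrow> b = v" using assms by (auto dest: inj_onD)
  then show ?case using add by (simp add: e)
qed simp

lemma graph_iso_size:
  assumes "graph_iso f G H"
  shows "size (edges H) = size (edges G)" "card (verts H) = card (verts G)"
  using assms bij_betw_same_card[of f "verts G" "verts H"] unfolding graph_iso_def
  by (metis size_image_mset)+

lemma graph_iso_degree:
  assumes "graph_iso f G H" "wf_mgraph G" "v \<in> verts G"
  shows "degree H (f v) = degree G v"
proof -
  have "edge_degree (image_mset (map_uprod f) (edges G)) (f v) = edge_degree (edges G) v"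
    by (rule edge_degree_image_mset[where V = "verts G"])
      (use assms in \<open>auto simp: graph_iso_def wf_mgraph_def bij_betw_def\<close>)
  then show ?thesis using assms(1) by (simp add: graph_iso_def degree_eq_edge_degree)
qed

lemma graph_iso_adjacent:
  assumes "graph_iso f G H" "adjacent G u v"
  shows "adjacent H (f u) (f v)"
proof -
  have "map_uprod f (Upair u v) \<in># image_mset (map_uprod f) (edges G)"
    using assms(2) unfolding adjacent_def by (metis imageI set_image_mset)
  moreover have "image_mset (map_uprod f) (edges G) = edges H" using assms(1) by (simp add: graph_iso_def)
  ultimately show ?thesis unfolding adjacent_def by (metis map_uprod_simps)
qed

lemma graph_iso_wf:
  assumes "graph_iso f G H" "wf_mgraph G"
  shows "wf_mgraph H"
proof -
  have "set_uprod e \<subseteq> verts H" if e: "e \<in># edges H" for e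
  proof -
    have "e \<in># image_mset (map_uprod f) (edges G)" using e assms(1) by (simp add: graph_iso_def)
    then obtain e' where "e' \<in># edges G" "e = map_uprod f e'" by auto
    moreover have "verts H = f ` verts G" using assms(1) by (simp add: graph_iso_def bij_betw_def)
    moreover have "set_uprod e' \<subseteq> verts G" using calculation assms(2) by (simp add: wf_mgraph_def)
    ultimately show ?thesis by (simp add: uprod.set_map image_mono)
  qed
  then show ?thesis using assms bij_betw_finite unfolding graph_iso_def wf_mgraph_def by blast
qed

lemma graph_iso_connected:
  assumes "graph_iso f G H" "connected_graph G"
  shows "connected_graph H"
proof (rule connected_graph_map[OF assms(2), where \<pi> = f])
  show "verts H = f ` verts G" using assms(1) by (simp add: graph_iso_def bij_betw_def)
qed (use graph_iso_adjacent[OF assms(1)] in blast)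

lemma graph_iso_tree:
  assumes "graph_iso f G H" "tree G"
  shows "tree H"
proof (rule treeI_size)
  show "wf_mgraph H" "connected_graph H"
    using graph_iso_wf[OF assms(1)] graph_iso_connected[OF assms(1)] assms(2)
    unfolding tree_def by blast+
  show "size (edges H) + 1 = card (verts H)"
    using graph_iso_size[OF assms(1)] tree_size[OF assms(2)] by simp
qed


section \<open>Phylogenetic networks that are trees\<close>

lemma phylogenetic_tree_iff:
  "phylogenetic_tree X T \<longleftrightarrow> tree T \<and> (\<forall>v\<in>verts T. degree T v \<noteq> 2) \<and> leaves T = X"
proof -
  have "bij_betw (\<lambda>x. x) X (leaves T) \<longleftrightarrow> leaves T = X" by (auto simp: bij_betw_def)
  then show ?thesis by (simp add: phylogenetic_tree_def labelled_phylo_tree_def)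
qed

lemma tree_no_blob:
  assumes "tree N"
  shows "\<not> blob N B"
proof
  assume "blob N B"
  then have B: "wf_mgraph B" "verts B \<subseteq> verts N" "edges B \<subseteq># edges N" "two_connected B"
    "2 \<le> size (edges B)"
    by (auto simp: blob_def subgraph_def)
  have acyc: "\<nexists>p. is_cycle B p"
    using is_cycle_subgraph[OF B(2,3)] assms unfolding tree_def by blast
  have simple: "simple_graph B"
    using tree_simple[of B] B(4) acyc B(1) by (simp add: tree_def two_connected_def)
  obtain e where "e \<in># edges B" using B(5) by fastforce
  moreover obtain v v' where "e = Upair v v'" by (cases e)
  ultimately have v: "adjacent B v v'" by (simp add: adjacent_def)
  obtain u w where u: "u \<in> verts B" "w \<in> verts B" "adjacent B u w"
    and pendant: "\<forall>z\<in>verts B. adjacent B u z \<longrightarrow> z = w"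
    using acyclic_pendant_vertex[OF B(1) acyc order_refl wf_adjacent_verts[OF B(1) v] v] by blast
  then have u4: "z = w" if "adjacent B u z" for z
    using that wf_adjacent_verts[OF B(1) that] by blast
  have uw: "u \<noteq> w" using u acyclic_no_loop[OF B(1) acyc] by auto
  have "\<exists>t\<in>verts B. t \<noteq> u \<and> t \<noteq> w"
  proof (rule ccontr)
    assume no: "\<not> ?thesis"
    have "{#e \<in># edges B. u \<notin> set_uprod e#} = {#}"
    proof (simp, intro allI impI notI)
      fix e assume e: "e \<in># edges B"
      show "u \<in> set_uprod e"
      proof (rule ccontr)
        assume ne: "u \<notin> set_uprod e"
        obtain a b where ab: "e = Upair a b" by (cases e)
        then have "a \<in> verts B" "b \<in> verts B" using e B(1) by (auto simp: wf_mgraph_def)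
        then have "a = w" "b = w" using no ne ab by auto
        then show False using e ab acyclic_no_loop[OF B(1) acyc] by (auto simp: adjacent_def)
      qed
    qed
    then have "size (edges B) = 1"
      using arg_cong[OF pendant_edges[OF simple u(3) u4], of size] by simp
    then show False using B(5) by simp
  qed
  then obtain t where t: "t \<in> verts B" "t \<noteq> u" "t \<noteq> w" by blast
  have "connected_graph (delete_vertex B w)" using B(4) u(2) by (simp add: two_connected_def)
  then have "verts (delete_vertex B w) \<subseteq> {u}"
  proof (rule connected_closed_set[where w = u])
    show "z \<in> {u}" if "s \<in> {u}" "adjacent (delete_vertex B w) s z" for s z
      using that u4[of z] by (simp add: adjacent_delete_vertex)
  qed (use u uw in auto)
  then show False using t by auto
qed

lemma graph_iso_contract_blobs:
  assumes "tree N"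
  shows "graph_iso (\<lambda>v. {v}) N (contract_blobs N)"
proof -
  have "same_blob N = (\<lambda>u v. False)"
    using tree_no_blob[OF assms] by (auto simp: same_blob_def fun_eq_iff)
  then have "v = u" if "(same_blob N)\<^sup>*\<^sup>* v u" for u v
    using that by (auto elim: converse_rtranclpE)
  then have "blob_class N = (\<lambda>v. {v})" unfolding blob_class_def fun_eq_iff by blast
  then show ?thesis
    using tree_no_blob[OF assms] by (simp add: graph_iso_def contract_blobs_def bij_betw_def)
qed

lemma tree_phylogenetic_network_iff:
  assumes "tree N"
  shows "phylogenetic_network X N \<longleftrightarrow> phylogenetic_tree X N"
proof -
  let ?s = "\<lambda>v. {v}" and ?C = "contract_blobs N"
  have iso: "graph_iso ?s N ?C" by (rule graph_iso_contract_blobs[OF assms])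
  then have verts: "verts ?C = ?s ` verts N" by (simp add: graph_iso_def bij_betw_def)
  have wf: "wf_mgraph N" using assms by (simp add: tree_def)
  have deg: "degree ?C {v} = degree N v" if "v \<in> verts N" for v
    using graph_iso_degree[OF iso wf that] .
  then have "leaves ?C = ?s ` leaves N" using verts by (auto simp: leaves_def)
  then have "bij_betw ?s X (leaves ?C) \<longleftrightarrow> leaves N = X"
    by (auto simp: bij_betw_def)
  then show ?thesis
    using assms tree_simple[OF assms] graph_iso_tree[OF iso assms] deg verts
    by (auto simp: phylogenetic_network_def phylogenetic_tree_iff labelled_phylo_tree_def tree_def)
qed

lemma network_leaf:
  assumes "phylogenetic_network X N" "x \<in> X"
  shows "x \<in> verts N" "degree N x = 1"
proof -
  let ?C = "contract_blobs N" and ?c = "blob_class N"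
  have "{x} \<in> leaves ?C"
    using assms by (auto simp: phylogenetic_network_def labelled_phylo_tree_def bij_betw_def)
  then have xC: "{x} \<in> verts ?C" and degC: "degree ?C {x} = 1" by (auto simp: leaves_def)
  have self: "v \<in> ?c v" for v by (simp add: blob_class_def)
  obtain v where v: "v \<in> verts N" "?c v = {x}" using xC by (auto simp: contract_blobs_def)
  then have x: "x \<in> verts N" "?c x = {x}" using self[of v] by auto
  then show "x \<in> verts N" by blast
  have no_blob: "x \<notin> verts B" if B: "blob N B" for B
  proof
    assume xB: "x \<in> verts B"
    then have "connected_graph (delete_vertex B x)" using B by (auto simp: blob_def two_connected_def)
    then obtain y where "y \<in> verts B" "y \<noteq> x" by (auto simp: connected_graph_def)
    then have "same_blob N x y" using B xB by (auto simp: same_blob_def)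
    then have "y \<in> ?c x" by (simp add: blob_class_def)
    then show False using x \<open>y \<noteq> x\<close> by simp
  qed
  have no_blob_edge: "x \<notin> set_uprod e" if "blob N B" "e \<in># edges B" for B e
    using no_blob[OF that(1)] that unfolding blob_def subgraph_def wf_mgraph_def by blast
  have simple: "simple_graph N" using assms(1) by (simp add: phylogenetic_network_def)
  have c_iff: "?c y = {x} \<longleftrightarrow> y = x" for y using x(2) self[of y] by auto
  have "{#e \<in># edges N. (\<nexists>B. blob N B \<and> e \<in># edges B) \<and> x \<in> set_uprod e#}
      = {#e \<in># edges N. x \<in> set_uprod e#}"
    by (rule filter_mset_cong) (use no_blob_edge in auto)
  moreover have edge_degree_image: "edge_degree (image_mset (map_uprod ?c) M) {x} = edge_degree M x" for M
  proof (induction M)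
    case (add e M)
    obtain a b where "e = Upair a b" by (cases e)
    then show ?case using add c_iff by simp
  qed simp
  ultimately have "size {#e \<in># edges N. x \<in> set_uprod e#}
      + count {#e \<in># edges N. \<nexists>B. blob N B \<and> e \<in># edges B#} (Upair x x) = 1"
    using degC
    by (simp add: degree_eq_edge_degree contract_blobs_def edge_degree_def filter_filter_mset conj_commute)
  moreover have "count (edges N) (Upair x x) = 0"
    using simple by (simp add: simple_graph_def count_eq_zero_iff)
  ultimately show "degree N x = 1" by (simp add: degree_def split: if_splits)
qed


section \<open>Suppression\<close>

lemma suppress_step_size:
  assumes "suppress_step G H" "finite (verts G)"
  shows "finite (verts H)" "size (edges H) + card (verts G) = size (edges G) + card (verts H)"
proof -
  from assms(1) have "finite (verts H) \<and>
    size (edges H) + card (verts G) = size (edges G) + card (verts H)"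
  proof cases
    case (1 v a b)
    have "2 \<le> size (edges G)" using size_mset_mono[OF 1(6)] by simp
    moreover have "0 < card (verts G)" using 1(2) assms(2) card_gt_0_iff by blast
    ultimately show ?thesis using assms(2) 1(1,2,6) by (simp add: size_Diff_submset)
  qed
  then show "finite (verts H)" "size (edges H) + card (verts G) = size (edges G) + card (verts H)"
    by blast+
qed

lemma suppress_steps_size:
  assumes "suppress_step\<^sup>*\<^sup>* G H" "finite (verts G)"
  shows "finite (verts H) \<and> size (edges H) + card (verts G) = size (edges G) + card (verts H)"
  using assms(1)
proof (induction rule: rtranclp_induct)
  case (step H K)
  then show ?case using suppress_step_size[OF step.hyps(2)] by simp
qed (use assms(2) in simp)

lemma suppress_size:
  assumes "finite (verts G)"
  shows "size (edges (suppress G)) + card (verts G) = size (edges G) + card (verts (suppress G))"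
proof -
  have "suppress_step\<^sup>*\<^sup>* G (suppress G)"
    using someI_ex[OF suppress_exists[OF assms]] by (simp add: suppress_def)
  then show ?thesis using suppress_steps_size assms by blast
qed

lemma suppress_id:
  assumes "\<nexists>H. suppress_step G H"
  shows "suppress G = G"
proof -
  have "suppress_step\<^sup>*\<^sup>* G H \<and> (\<nexists>H'. suppress_step H H') \<longleftrightarrow> H = G" for H
    using assms by (metis converse_rtranclpE rtranclp.rtrancl_refl)
  then show ?thesis by (simp add: suppress_def)
qed

lemma suppress_single_step:
  assumes "suppress_step G H" "\<And>H'. suppress_step G H' \<Longrightarrow> H' = H" "\<nexists>K. suppress_step H K"
  shows "suppress G = H"
proof -
  have "suppress_step\<^sup>*\<^sup>* G K \<and> (\<nexists>K'. suppress_step K K') \<longleftrightarrow> K = H" for K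
  proof
    assume K: "suppress_step\<^sup>*\<^sup>* G K \<and> (\<nexists>K'. suppress_step K K')"
    then have "K \<noteq> G" using assms(1) by blast
    then obtain G' where "suppress_step G G'" "suppress_step\<^sup>*\<^sup>* G' K"
      using K by (metis converse_rtranclpE)
    then show "K = H" using assms(2,3) by (metis converse_rtranclpE)
  next
    assume "K = H"
    then show "suppress_step\<^sup>*\<^sup>* G K \<and> (\<nexists>K'. suppress_step K K')" using assms by blast
  qed
  then show ?thesis by (simp add: suppress_def)
qed

lemma no_suppress_step: "(\<And>v. v \<in> verts G \<Longrightarrow> degree G v \<noteq> 2) \<Longrightarrow> \<nexists>H. suppress_step G H"
  by (auto elim: suppress_step.cases)

lemma suppress_unique_vertex:
  assumes G: "edges G = F + {#Upair p a, Upair p b#}" "p \<in> verts G" "a \<noteq> p" "b \<noteq> p"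
    and F: "\<And>e. e \<in># F \<Longrightarrow> p \<notin> set_uprod e"
    and deg: "\<And>v. v \<in> verts G \<Longrightarrow> v \<noteq> p \<Longrightarrow> degree G v \<noteq> 2"
  shows "suppress G = \<lparr>verts = verts G - {p}, edges = add_mset (Upair a b) F\<rparr>" (is "_ = ?H")
proof (rule suppress_single_step)
  have F0: "edge_degree F p = 0" using F by (rule edge_degree_eq_0)
  have degp: "degree G p = 2" using G F0 by (simp add: degree_eq_edge_degree)
  have "{#Upair p a, Upair p b#} \<subseteq># edges G" unfolding G(1) by simp
  from suppress_step.intros[OF G(2) degp G(3,4) this] show "suppress_step G ?H"
    by (simp add: G(1))
  show "H' = ?H" if "suppress_step G H'" for H'
    using that
  proof cases
    case (1 v a' b')
    then have v: "v = p" using deg by blast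
    have "filter_mset (\<lambda>e. p \<in> set_uprod e) F = {#}" using F by simp
    then have "filter_mset (\<lambda>e. p \<in> set_uprod e) (edges G) = {#Upair p a, Upair p b#}"
      by (simp add: G(1))
    moreover have "{#Upair p a', Upair p b'#} \<subseteq># filter_mset (\<lambda>e. p \<in> set_uprod e) (edges G)"
      using multiset_filter_mono[OF 1(6), of "\<lambda>e. p \<in> set_uprod e"] v by simp
    ultimately have eq: "{#Upair p a', Upair p b'#} = {#Upair p a, Upair p b#}"
      by (metis size_add_mset size_empty subset_mset.le_neq_trans mset_subset_size less_irrefl)
    then have "Upair a' b' = Upair a b"
      by (auto simp: add_eq_conv_ex add_mset_eq_single)
    moreover have "edges G - {#Upair v a', Upair v b'#} = F" using eq v by (simp add: G(1))
    ultimately show ?thesis using 1(1) v by simp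
  qed
  show "\<nexists>K. suppress_step ?H K"
  proof (rule no_suppress_step)
    fix v assume v: "v \<in> verts ?H"
    then have "degree ?H v = degree G v" using G by (auto simp: degree_eq_edge_degree)
    then show "degree ?H v \<noteq> 2" using v deg by simp
  qed
qed

lemma simple_degree:
  assumes "simple_graph G"
  shows "degree G v = size {#e \<in># edges G. v \<in> set_uprod e#}"
proof -
  have "count (edges G) (Upair v v) = 0"
    using assms by (simp add: simple_graph_def count_eq_zero_iff)
  then show ?thesis by (simp add: degree_def)
qed

lemma network_is_tree:
  assumes N: "phylogenetic_network X N" "x \<in> X"
    and H: "equivalent Y (vertex_deleted N x) H" "tree H"
  shows "phylogenetic_tree X N"
proof -
  have simple: "simple_graph N" and con: "connected_graph N"
    using N by (auto simp: phylogenetic_network_def)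
  then have fin: "finite (verts N)" and wf: "wf_mgraph N"
    by (auto simp: simple_graph_def wf_mgraph_def)
  have "size {#e \<in># edges N. x \<in> set_uprod e#} = 1"
    using network_leaf(2)[OF N] simple_degree[OF simple] by metis
  moreover have "size (edges N) =
      size {#e \<in># edges N. x \<in> set_uprod e#} + size {#e \<in># edges N. x \<notin> set_uprod e#}"
    by (metis multiset_partition size_union)
  ultimately have size: "size (edges N) = Suc (size (edges (delete_vertex N x)))"
    by (simp add: edges_delete_vertex)
  have "0 < card (verts N)" using network_leaf(1)[OF N] fin card_gt_0_iff by blast
  then have card: "card (verts N) = Suc (card (verts (delete_vertex N x)))"
    using network_leaf(1)[OF N] by simp
  obtain f where "graph_iso f (vertex_deleted N x) H"
    using H(1) by (auto simp: equivalent_iff_graph_iso)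
  then have "size (edges (vertex_deleted N x)) + 1 = card (verts (vertex_deleted N x))"
    using graph_iso_size tree_size[OF H(2)] by metis
  moreover have "size (edges (vertex_deleted N x)) + card (verts (delete_vertex N x))
      = size (edges (delete_vertex N x)) + card (verts (vertex_deleted N x))"
    unfolding vertex_deleted_def by (rule suppress_size) (use fin in simp)
  ultimately have "size (edges N) + 1 = card (verts N)" using size card by simp
  then have "tree N" using treeI_size wf con by blast
  then show ?thesis using tree_phylogenetic_network_iff N(1) by blast
qed


section \<open>Local structure at the leaves\<close>

definition nbr :: "'v mgraph \<Rightarrow> 'v \<Rightarrow> 'v" where
  "nbr G x = (THE p. adjacent G x p)"

lemma size_eq_card_set_mset:
  assumes "\<And>e. count M e \<le> 1"
  shows "size M = card (set_mset M)"
proof -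
  have "count M e = count (mset_set (set_mset M)) e" for e
    using assms[of e] by (cases "e \<in># M") (auto simp: count_eq_zero_iff le_Suc_eq)
  then have "M = mset_set (set_mset M)" by (rule multiset_eqI)
  then show ?thesis by (metis size_mset_set)
qed

lemma simple_degree_card:
  assumes "simple_graph G"
  shows "finite {z. adjacent G v z}" "degree G v = card {z. adjacent G v z}"
proof -
  let ?M = "{#e \<in># edges G. v \<in> set_uprod e#}"
  have wf: "wf_mgraph G" using assms by (simp add: simple_graph_def)
  have "{z. adjacent G v z} \<subseteq> verts G" using wf_adjacent_verts[OF wf] by blast
  then show "finite {z. adjacent G v z}" using wf finite_subset by (auto simp: wf_mgraph_def)
  have "set_mset ?M = Upair v ` {z. adjacent G v z}"
    using uprod_with_member by (fastforce simp: adjacent_def)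
  moreover have "inj_on (Upair v) {z. adjacent G v z}" by (auto simp: inj_on_def)
  moreover have "size ?M = card (set_mset ?M)"
    by (rule size_eq_card_set_mset) (use assms in \<open>simp add: simple_graph_def\<close>)
  ultimately show "degree G v = card {z. adjacent G v z}"
    by (simp add: simple_degree[OF assms] card_image)
qed

locale phylo =
  fixes X :: "'v set" and G :: "'v mgraph"
  assumes phylogenetic: "phylogenetic_tree X G" and card_X: "3 \<le> card X"
begin

lemma is_tree: "tree G"
  using phylogenetic by (simp add: phylogenetic_tree_iff)

lemma wf: "wf_mgraph G" and connected: "connected_graph G" and acyclic: "\<nexists>p. is_cycle G p"
  using is_tree by (auto simp: tree_def)

lemma simple: "simple_graph G"
  using is_tree by (rule tree_simple)

lemma no_loop: "\<not> adjacent G v v"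
  using acyclic_no_loop[OF wf acyclic] .

lemma finite_verts: "finite (verts G)"
  using wf by (simp add: wf_mgraph_def)

lemma degree_not_2: "v \<in> verts G \<Longrightarrow> degree G v \<noteq> 2"
  using phylogenetic by (simp add: phylogenetic_tree_iff)

lemma mem_X_iff: "v \<in> X \<longleftrightarrow> v \<in> verts G \<and> degree G v = 1"
  using phylogenetic by (auto simp: phylogenetic_tree_iff leaves_def)

lemma X_subset_verts: "X \<subseteq> verts G"
  using mem_X_iff by blast

lemma adjacent_leaf_iff:
  assumes "x \<in> X"
  shows "adjacent G x z \<longleftrightarrow> z = nbr G x"
proof -
  have "card {z. adjacent G x z} = 1"
    using assms simple_degree_card(2)[OF simple, of x] by (simp add: mem_X_iff)
  then obtain p where "{z. adjacent G x z} = {p}" by (rule card_1_singletonE)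
  then have "adjacent G x z \<longleftrightarrow> z = p" for z by blast
  then show ?thesis by (simp add: nbr_def)
qed

lemma adjacent_nbr: "x \<in> X \<Longrightarrow> adjacent G x (nbr G x)"
  by (simp add: adjacent_leaf_iff)

lemma nbr_verts: "x \<in> X \<Longrightarrow> nbr G x \<in> verts G"
  using adjacent_nbr wf_adjacent_verts[OF wf] by blast

lemma nbr_neq: "x \<in> X \<Longrightarrow> nbr G x \<noteq> x"
  using adjacent_nbr no_loop by metis

lemma leaf_edges:
  assumes "x \<in> X"
  shows "edges G = add_mset (Upair x (nbr G x)) {#e \<in># edges G. x \<notin> set_uprod e#}"
  by (rule pendant_edges[OF simple adjacent_nbr[OF assms]]) (simp add: adjacent_leaf_iff assms)

lemma closed_set_contains_X:
  assumes "w \<in> W" "w \<in> verts G" "\<And>u v. u \<in> W \<Longrightarrow> adjacent G u v \<Longrightarrow> v \<in> W"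
  shows "X \<subseteq> W"
proof -
  have "verts G \<subseteq> W" by (rule connected_closed_set[OF connected assms(1,2)]) (rule assms(3))
  then show ?thesis using X_subset_verts by blast
qed

lemma nbr_not_leaf:
  assumes "x \<in> X"
  shows "nbr G x \<notin> X"
proof
  assume p: "nbr G x \<in> X"
  have "nbr G (nbr G x) = x"
    using adjacent_nbr[OF assms] adjacent_leaf_iff[OF p] by (simp add: adjacent_sym)
  then have "X \<subseteq> {x, nbr G x}"
    by (intro closed_set_contains_X[of x])
      (use assms p X_subset_verts in \<open>auto simp: adjacent_leaf_iff\<close>)
  then have "card X \<le> card {x, nbr G x}" by (rule card_mono[rotated]) simp
  also have "\<dots> \<le> 2" by (simp add: card_insert_if)
  finally show False using card_X by simp
qed

lemma nbr_degree:
  assumes "x \<in> X"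
  shows "3 \<le> degree G (nbr G x)"
proof -
  have "degree G (nbr G x) \<noteq> 0"
    using arg_cong[OF leaf_edges[OF assms], of "\<lambda>M. edge_degree M (nbr G x)"]
    by (simp add: degree_eq_edge_degree)
  moreover have "degree G (nbr G x) \<noteq> 1" "degree G (nbr G x) \<noteq> 2"
    using nbr_not_leaf[OF assms] nbr_verts[OF assms] degree_not_2 by (auto simp: mem_X_iff)
  ultimately show ?thesis by linarith
qed

lemma all_neighbours:
  assumes "A \<subseteq> {z. adjacent G v z}" "degree G v \<le> card A" "adjacent G v z"
  shows "z \<in> A"
  using card_seteq[OF simple_degree_card(1)[OF simple] assms(1)] assms(2,3)
    simple_degree_card(2)[OF simple, of v] by auto

lemma degree_ge_card:
  assumes "A \<subseteq> {z. adjacent G v z}"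
  shows "card A \<le> degree G v"
  using card_mono[OF simple_degree_card(1)[OF simple] assms] simple_degree_card(2)[OF simple, of v]
  by simp

lemma cubic_nbr_edges:
  assumes x: "x \<in> X" and deg: "degree G (nbr G x) = 3"
  obtains a b F where "edges G = F + {#Upair (nbr G x) x, Upair (nbr G x) a, Upair (nbr G x) b#}"
    "\<And>e. e \<in># F \<Longrightarrow> nbr G x \<notin> set_uprod e \<and> x \<notin> set_uprod e"
    "distinct [nbr G x, x, a, b]" "a \<in> verts G" "b \<in> verts G"
    "\<And>z. adjacent G (nbr G x) z \<longleftrightarrow> z = x \<or> z = a \<or> z = b"
proof -
  let ?p = "nbr G x"
  let ?N = "{z. adjacent G ?p z}"
  have fin: "finite ?N" and card: "card ?N = 3"
    using simple_degree_card[OF simple, of ?p] deg by auto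
  have xN: "x \<in> ?N" using adjacent_nbr[OF x] by (simp add: adjacent_sym)
  then have "card (?N - {x}) = 2" using card fin by simp
  then obtain a b where ab: "?N - {x} = {a, b}" "a \<noteq> b" by (meson card_2_iff)
  have N: "?N = {x, a, b}" using ab xN by auto
  then have adj: "adjacent G ?p z \<longleftrightarrow> z = x \<or> z = a \<or> z = b" for z by blast
  have dist: "distinct [?p, x, a, b]"
    using ab nbr_neq[OF x] adj no_loop[of ?p] by auto
  define F where "F = {#e \<in># edges G. ?p \<notin> set_uprod e#}"
  let ?M = "{#e \<in># edges G. ?p \<in> set_uprod e#}"
  let ?K = "{#Upair ?p x, Upair ?p a, Upair ?p b#}"
  have K: "?K \<subseteq># ?M"
  proof -
    have "?K = mset_set (set_mset ?K)" using dist by simp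
    moreover have "set_mset ?K \<subseteq> set_mset ?M" using adj by (auto simp: adjacent_def)
    then have "mset_set (set_mset ?K) \<subseteq># mset_set (set_mset ?M)"
      by (rule subset_imp_msubset_mset_set) simp
    ultimately show ?thesis using mset_set_set_mset_msubset subset_mset.order_trans by metis
  qed
  moreover have "size ?M = 3" using deg simple_degree[OF simple] by metis
  ultimately have "?M = ?K"
    using mset_subset_size[of ?K ?M] by (auto simp: subset_mset.le_less)
  then have "edges G = F + ?K"
    using multiset_partition[of "edges G" "\<lambda>e. ?p \<in> set_uprod e"] by (simp add: F_def)
  moreover have "?p \<notin> set_uprod e \<and> x \<notin> set_uprod e" if e: "e \<in># F" for e
  proof -
    have p: "e \<in># edges G" "?p \<notin> set_uprod e" using e by (auto simp: F_def)
    have "x \<notin> set_uprod e"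
    proof
      assume "x \<in> set_uprod e"
      then obtain z where z: "e = Upair x z" using uprod_with_member by metis
      then have "z = ?p" using p(1) adjacent_leaf_iff[OF x] by (simp add: adjacent_def)
      then show False using p(2) z by simp
    qed
    then show ?thesis using p by blast
  qed
  moreover have "a \<in> verts G" "b \<in> verts G" using adj wf_adjacent_verts[OF wf] by blast+
  ultimately show ?thesis using that dist adj by blast
qed

lemma degree_delete_leaf:
  assumes "x \<in> X" "v \<noteq> x"
  shows "degree (delete_vertex G x) v = degree G v - (if v = nbr G x then 1 else 0)"
  using arg_cong[OF leaf_edges[OF assms(1)], of "\<lambda>M. edge_degree M v"] assms(2)
  by (auto simp: degree_eq_edge_degree edges_delete_vertex)

lemma vertex_deleted_high:
  assumes "x \<in> X" "4 \<le> degree G (nbr G x)"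
  shows "vertex_deleted G x = delete_vertex G x"
  unfolding vertex_deleted_def
proof (rule suppress_id, rule no_suppress_step)
  fix v assume "v \<in> verts (delete_vertex G x)"
  then have "degree (delete_vertex G x) v = degree G v - (if v = nbr G x then 1 else 0)"
    and "v \<in> verts G"
    using degree_delete_leaf[OF assms(1)] by auto
  then show "degree (delete_vertex G x) v \<noteq> 2"
    using degree_not_2[of v] assms(2) by (auto split: if_splits)
qed

lemma vertex_deleted_cubic:
  assumes x: "x \<in> X" and p: "p \<in> verts G"
    and edges: "edges G = F + {#Upair p x, Upair p a, Upair p b#}"
    and F: "\<And>e. e \<in># F \<Longrightarrow> p \<notin> set_uprod e \<and> x \<notin> set_uprod e"
    and dist: "distinct [p, x, a, b]"
  shows "vertex_deleted G x = \<lparr>verts = verts G - {x, p}, edges = add_mset (Upair a b) F\<rparr>"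
proof -
  let ?D = "delete_vertex G x"
  have "{#e \<in># F. x \<notin> set_uprod e#} = F" using F by (simp add: filter_mset_eq_conv)
  then have eD: "edges ?D = F + {#Upair p a, Upair p b#}"
    using dist by (auto simp: edges_delete_vertex edges)
  have "suppress ?D = \<lparr>verts = verts ?D - {p}, edges = add_mset (Upair a b) F\<rparr>"
  proof (rule suppress_unique_vertex[OF eD])
    fix v assume v: "v \<in> verts ?D" "v \<noteq> p"
    then have "degree ?D v = degree G v" by (auto simp: degree_eq_edge_degree eD edges)
    then show "degree ?D v \<noteq> 2" using degree_not_2 v by simp
  qed (use dist p F in auto)
  moreover have "verts ?D - {p} = verts G - {x, p}" by auto
  ultimately show ?thesis by (simp add: vertex_deleted_def)
qed

end


context phylo
begin

lemma cubic_leaf_deletion: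
  assumes x: "x \<in> X" and deg: "degree G (nbr G x) = 3"
  obtains F a b where "edges G = F + {#Upair (nbr G x) x, Upair (nbr G x) a, Upair (nbr G x) b#}"
    "\<forall>e\<in>#F. nbr G x \<notin> set_uprod e \<and> x \<notin> set_uprod e"
    "distinct [nbr G x, x, a, b]" "a \<in> verts G" "b \<in> verts G"
    "\<forall>z. adjacent G (nbr G x) z \<longleftrightarrow> z = x \<or> z = a \<or> z = b"
    "vertex_deleted G x = \<lparr>verts = verts G - {x, nbr G x}, edges = add_mset (Upair a b) F\<rparr>"
    "\<forall>v. v \<noteq> x \<and> v \<noteq> nbr G x \<longrightarrow> degree (vertex_deleted G x) v = degree G v"
    "\<forall>z\<in>X - {x}. nbr (vertex_deleted G x) z =
       (if z = a then b else if z = b then a else nbr G z)"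
proof -
  let ?p = "nbr G x" and ?D = "vertex_deleted G x"
  obtain F a b where edges: "edges G = F + {#Upair ?p x, Upair ?p a, Upair ?p b#}"
    and F: "\<And>e. e \<in># F \<Longrightarrow> ?p \<notin> set_uprod e \<and> x \<notin> set_uprod e"
    and dist: "distinct [?p, x, a, b]" and ab: "a \<in> verts G" "b \<in> verts G"
    and adj: "\<And>z. adjacent G ?p z \<longleftrightarrow> z = x \<or> z = a \<or> z = b"
    by (rule cubic_nbr_edges[OF assms]) blast
  have D: "?D = \<lparr>verts = verts G - {x, ?p}, edges = add_mset (Upair a b) F\<rparr>"
    by (rule vertex_deleted_cubic[OF x nbr_verts[OF x] edges F dist])
  have "degree ?D v = degree G v" if "v \<noteq> x" "v \<noteq> ?p" for v
    using that by (auto simp: degree_eq_edge_degree D edges)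
  moreover have "nbr ?D z = (if z = a then b else if z = b then a else nbr G z)" (is "_ = ?r")
    if z: "z \<in> X" "z \<noteq> x" for z
  proof -
    have "?p \<noteq> z" using nbr_not_leaf[OF x] z by auto
    have G: "adjacent G z t \<longleftrightarrow> Upair z t \<in># F \<or> (t = ?p \<and> (z = a \<or> z = b))" for t
      using z \<open>?p \<noteq> z\<close> dist by (auto simp: adjacent_def edges)
    have "adjacent ?D z t \<longleftrightarrow> t = ?r" for t
    proof -
      have "adjacent ?D z t \<longleftrightarrow> Upair z t \<in># F \<or> (z = a \<and> t = b) \<or> (z = b \<and> t = a)"
        by (auto simp: adjacent_def D)
      moreover have "Upair z t \<notin># F" if "z = a \<or> z = b"
      proof
        assume "Upair z t \<in># F"
        then have "t \<noteq> ?p" "adjacent G z t" using F[of "Upair z t"] G by auto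
        moreover have "adjacent G z ?p" using G that by blast
        ultimately show False using adjacent_leaf_iff[OF z(1)] by metis
      qed
      moreover have "Upair z t \<in># F \<longleftrightarrow> t = nbr G z" if "\<not> (z = a \<or> z = b)"
        using that G[of t] adjacent_leaf_iff[OF z(1)] by simp
      ultimately show ?thesis using dist by auto
    qed
    then show ?thesis by (simp add: nbr_def[of ?D])
  qed
  ultimately show ?thesis using that[OF edges _ dist ab _ D] F adj by simp
qed

lemma degree_vertex_deleted_high:
  assumes "x \<in> X" "4 \<le> degree G (nbr G x)" "v \<noteq> x"
  shows "degree (vertex_deleted G x) v = degree G v - (if v = nbr G x then 1 else 0)"
  using degree_delete_leaf[OF assms(1,3)] vertex_deleted_high[OF assms(1,2)] by simp

lemma nbr_vertex_deleted_high:
  assumes "x \<in> X" "4 \<le> degree G (nbr G x)" "z \<in> X" "z \<noteq> x"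
  shows "nbr (vertex_deleted G x) z = nbr G z"
proof -
  have "nbr G z \<noteq> x" using nbr_not_leaf assms by metis
  then have "adjacent (vertex_deleted G x) z t \<longleftrightarrow> t = nbr G z" for t
    using assms(4) adjacent_leaf_iff[OF assms(3)]
    by (auto simp: vertex_deleted_high[OF assms(1,2)] adjacent_delete_vertex)
  then show ?thesis by (simp add: nbr_def[of "vertex_deleted G x"])
qed

lemma nbr_degree_cases:
  assumes "x \<in> X"
  obtains "degree G (nbr G x) = 3" | "4 \<le> degree G (nbr G x)"
  using nbr_degree[OF assms] by linarith

lemma phylogenetic_vertex_deleted:
  assumes x: "x \<in> X"
  shows "phylogenetic_tree (X - {x}) (vertex_deleted G x)"
proof (rule nbr_degree_cases[OF x])
  let ?p = "nbr G x" and ?D = "vertex_deleted G x"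
  have card: "0 < card (verts G)" using finite_verts nbr_verts[OF x] card_gt_0_iff by blast
  have xp: "x \<in> verts G" "?p \<in> verts G" "?p \<noteq> x" "?p \<notin> X"
    using X_subset_verts x nbr_verts nbr_neq nbr_not_leaf by auto
  {
    assume deg: "4 \<le> degree G ?p"
    have D: "?D = delete_vertex G x" by (rule vertex_deleted_high[OF x deg])
    have "connected_graph ?D" unfolding D
      by (rule connected_delete_pendant[OF connected xp(2,3)]) (simp add: adjacent_leaf_iff[OF x])
    moreover have "size (edges ?D) + 1 = card (verts ?D)"
      using arg_cong[OF leaf_edges[OF x], of size] tree_size[OF is_tree] xp(1) finite_verts card
      by (simp add: D edges_delete_vertex)
    ultimately have "tree ?D" using wf_delete_vertex[OF wf] D by (metis treeI_size)
    moreover have "degree ?D v \<noteq> 2" if "v \<in> verts ?D" for v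
      using degree_vertex_deleted_high[OF x deg, of v] degree_not_2[of v] that deg
      by (auto simp: D split: if_splits)
    moreover have "v \<in> leaves ?D \<longleftrightarrow> v \<in> X - {x}" for v
    proof (cases "v = x")
      case True
      then show ?thesis by (simp add: D leaves_def)
    next
      case False
      then show ?thesis
        using degree_vertex_deleted_high[OF x deg False] deg xp(4)
        by (cases "v = ?p") (auto simp: leaves_def mem_X_iff D)
    qed
    ultimately show ?thesis by (auto simp: phylogenetic_tree_iff)
  }
  {
    assume deg: "degree G ?p = 3"
    obtain F a b where edges: "edges G = F + {#Upair ?p x, Upair ?p a, Upair ?p b#}"
      and F: "\<forall>e\<in>#F. ?p \<notin> set_uprod e \<and> x \<notin> set_uprod e"
      and dist: "distinct [?p, x, a, b]" and ab: "a \<in> verts G" "b \<in> verts G"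
      and adj: "\<forall>z. adjacent G ?p z \<longleftrightarrow> z = x \<or> z = a \<or> z = b"
      and D: "?D = \<lparr>verts = verts G - {x, ?p}, edges = add_mset (Upair a b) F\<rparr>"
      and degD: "\<forall>v. v \<noteq> x \<and> v \<noteq> ?p \<longrightarrow> degree ?D v = degree G v"
      by (rule cubic_leaf_deletion[OF x deg])
    have wfD: "wf_mgraph ?D"
    proof -
      have "set_uprod e \<subseteq> verts G - {x, ?p}" if e: "e \<in># F" for e
        using F wf e by (auto simp: wf_mgraph_def edges)
      then show ?thesis using ab dist finite_verts by (auto simp: wf_mgraph_def D)
    qed
    let ?\<pi> = "\<lambda>v. if v = x \<or> v = ?p then a else v"
    have "connected_graph ?D"
    proof (rule connected_graph_map[OF connected, where \<pi> = ?\<pi>])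
      show "verts ?D = ?\<pi> ` verts G" using xp ab dist by (auto simp: D)
      fix s t assume "adjacent G s t"
      then have "Upair s t \<in># F \<or> Upair s t = Upair ?p x \<or> Upair s t = Upair ?p a \<or>
          Upair s t = Upair ?p b"
        by (simp only: adjacent_def edges) auto
      moreover have "adjacent ?D s t \<and> s \<notin> {x, ?p} \<and> t \<notin> {x, ?p}" if st: "Upair s t \<in># F"
        using F st by (auto simp: adjacent_def D)
      moreover have "adjacent ?D a b" "adjacent ?D b a" by (auto simp: adjacent_def D)
      ultimately show "(adjacent ?D)\<^sup>*\<^sup>* (?\<pi> s) (?\<pi> t)" using dist by auto
    qed
    moreover have "size (edges ?D) + 1 = card (verts ?D)"
    proof -
      have "card (verts G - {x, ?p}) = card (verts G) - 2"
        using xp by (simp add: card_Diff_subset)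
      then show ?thesis using tree_size[OF is_tree] by (simp add: D edges)
    qed
    ultimately have "tree ?D" using wfD by (metis treeI_size)
    moreover have "degree ?D v \<noteq> 2" if "v \<in> verts ?D" for v
      using degD degree_not_2[of v] that by (simp add: D)
    moreover have "v \<in> leaves ?D \<longleftrightarrow> v \<in> X - {x}" for v
    proof (cases "v = x \<or> v = ?p")
      case True
      then show ?thesis using xp(4) by (auto simp: D leaves_def)
    next
      case False
      then have "v \<in> leaves ?D \<longleftrightarrow> v \<in> verts G \<and> degree G v = 1"
        using degD by (simp add: leaves_def D)
      then show ?thesis using False by (simp add: mem_X_iff)
    qed
    ultimately show ?thesis by (auto simp: phylogenetic_tree_iff)
  }
qed

end

lemma phylo_vertex_deleted:
  assumes "phylo X G" "x \<in> X" "4 \<le> card X"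
  shows "phylo (X - {x}) (vertex_deleted G x)"
proof -
  interpret phylo X G by fact
  show ?thesis
    using phylogenetic_vertex_deleted[OF assms(2)] assms(2,3) by unfold_locales auto
qed

lemma graph_iso_nbr:
  assumes "phylo Y G" "phylo Y H" "graph_iso f G H" "\<forall>y\<in>Y. f y = y" "y \<in> Y"
  shows "nbr H y = f (nbr G y)"
proof -
  interpret G: phylo Y G by fact
  interpret H: phylo Y H by fact
  have "adjacent H y (f (nbr G y))"
    using graph_iso_adjacent[OF assms(3) G.adjacent_nbr[OF assms(5)]] assms(4,5) by simp
  then show ?thesis using H.adjacent_leaf_iff[OF assms(5)] by simp
qed

lemma equivalent_nbr:
  assumes "phylo Y G" "phylo Y H" "equivalent Y G H"
  shows "y \<in> Y \<Longrightarrow> degree H (nbr H y) = degree G (nbr G y)"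
    and "y \<in> Y \<Longrightarrow> z \<in> Y \<Longrightarrow> nbr H y = nbr H z \<longleftrightarrow> nbr G y = nbr G z"
proof -
  interpret G: phylo Y G by fact
  obtain f where f: "graph_iso f G H" "\<forall>y\<in>Y. f y = y"
    using assms(3) by (auto simp: equivalent_iff_graph_iso)
  note nbr = graph_iso_nbr[OF assms(1,2) f]
  have inj: "inj_on f (verts G)" using f(1) by (simp add: graph_iso_def bij_betw_def)
  show "degree H (nbr H y) = degree G (nbr G y)" if "y \<in> Y"
    using graph_iso_degree[OF f(1) G.wf G.nbr_verts[OF that]] nbr[OF that] by simp
  show "nbr H y = nbr H z \<longleftrightarrow> nbr G y = nbr G z" if "y \<in> Y" "z \<in> Y"
    using inj_on_eq_iff[OF inj G.nbr_verts[OF that(1)] G.nbr_verts[OF that(2)]]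
      nbr[OF that(1)] nbr[OF that(2)] by simp
qed


section \<open>Extending an isomorphism to the deleted leaf\<close>

lemma image_mset_map_uprod_cong:
  assumes "\<And>e v. e \<in># M \<Longrightarrow> v \<in> set_uprod e \<Longrightarrow> f v = g v"
  shows "image_mset (map_uprod f) M = image_mset (map_uprod g) M"
  using assms by (intro image_mset_cong uprod.map_cong) auto

lemma extend_equivalent_high:
  assumes N: "phylo X N" and T: "phylo X T" and card: "4 \<le> card X"
    and x: "x \<in> X" "x' \<in> X" "x \<noteq> x'"
    and Nx: "nbr N x = nbr N x'" "4 \<le> degree N (nbr N x)"
    and Tx: "nbr T x = nbr T x'" "4 \<le> degree T (nbr T x)"
    and eq: "equivalent (X - {x}) (vertex_deleted N x) (vertex_deleted T x)"
  shows "equivalent X N T"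
proof -
  interpret N: phylo X N by fact
  interpret T: phylo X T by fact
  obtain f where f: "graph_iso f (vertex_deleted N x) (vertex_deleted T x)" "\<forall>y\<in>X - {x}. f y = y"
    using eq by (auto simp: equivalent_iff_graph_iso)
  have "f (nbr N x) = nbr T x"
    using graph_iso_nbr[OF phylo_vertex_deleted[OF N x(1) card] phylo_vertex_deleted[OF T x(1) card]
        f, of x'] x N.nbr_vertex_deleted_high[OF x(1) Nx(2) x(2)] Nx(1)
      T.nbr_vertex_deleted_high[OF x(1) Tx(2) x(2)] Tx(1) by auto
  have f': "bij_betw f (verts N - {x}) (verts T - {x})"
    "image_mset (map_uprod f) {#e \<in># edges N. x \<notin> set_uprod e#} = {#e \<in># edges T. x \<notin> set_uprod e#}"
    using f(1) N.vertex_deleted_high[OF x(1) Nx(2)] T.vertex_deleted_high[OF x(1) Tx(2)]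
    by (auto simp: graph_iso_def edges_delete_vertex)
  let ?g = "f(x := x)"
  have xN: "verts N = insert x (verts N - {x})" "verts T = insert x (verts T - {x})"
    using N.X_subset_verts T.X_subset_verts x(1) by auto
  have "bij_betw ?g (verts N - {x}) (verts T - {x})"
    using f'(1) bij_betw_cong[of "verts N - {x}" ?g f] by simp
  then have "bij_betw ?g (insert x (verts N - {x})) (insert x (verts T - {x}))"
    using notIn_Un_bij_betw[of x "verts N - {x}" ?g "verts T - {x}"] by simp
  then have bij: "bij_betw ?g (verts N) (verts T)" using xN by simp
  have "image_mset (map_uprod ?g) {#e \<in># edges N. x \<notin> set_uprod e#}
      = image_mset (map_uprod f) {#e \<in># edges N. x \<notin> set_uprod e#}"
    by (rule image_mset_map_uprod_cong) auto
  then have "image_mset (map_uprod ?g) (add_mset (Upair x (nbr N x)) {#e \<in># edges N. x \<notin> set_uprod e#})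
      = add_mset (Upair x (nbr T x)) {#e \<in># edges T. x \<notin> set_uprod e#}"
    using f'(2) \<open>f (nbr N x) = nbr T x\<close> N.nbr_neq[OF x(1)] by simp
  then have "image_mset (map_uprod ?g) (edges N) = edges T"
    using N.leaf_edges[OF x(1)] T.leaf_edges[OF x(1)] by metis
  moreover have "\<forall>y\<in>X. ?g y = y" using f(2) by simp
  ultimately show ?thesis using bij unfolding equivalent_def by blast
qed

lemma extend_equivalent_cubic:
  assumes N: "phylo X N" and T: "phylo X T" and card: "4 \<le> card X"
    and x: "x \<in> X" "x' \<in> X" "x \<noteq> x'"
    and Nx: "nbr N x = nbr N x'" "degree N (nbr N x) = 3"
    and Tx: "nbr T x = nbr T x'" "degree T (nbr T x) = 3"
    and eq: "equivalent (X - {x}) (vertex_deleted N x) (vertex_deleted T x)"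
  shows "equivalent X N T"
proof -
  have cherry_split: "\<exists>F c. edges G = F + {#Upair (nbr G x) x, Upair (nbr G x) x', Upair (nbr G x) c#} \<and>
      (\<forall>e\<in>#F. nbr G x \<notin> set_uprod e \<and> x \<notin> set_uprod e) \<and> c \<noteq> x \<and> c \<noteq> nbr G x \<and>
      vertex_deleted G x = \<lparr>verts = verts G - {x, nbr G x}, edges = add_mset (Upair x' c) F\<rparr> \<and>
      nbr (vertex_deleted G x) x' = c"
    if G: "phylo X G" and Gx: "nbr G x = nbr G x'" "degree G (nbr G x) = 3" for G
  proof -
    interpret G: phylo X G by fact
    obtain F a b where edges: "edges G = F + {#Upair (nbr G x) x, Upair (nbr G x) a, Upair (nbr G x) b#}"
      and F: "\<forall>e\<in>#F. nbr G x \<notin> set_uprod e \<and> x \<notin> set_uprod e"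
      and dist: "distinct [nbr G x, x, a, b]" and ab: "a \<in> verts G" "b \<in> verts G"
      and adj: "\<forall>z. adjacent G (nbr G x) z \<longleftrightarrow> z = x \<or> z = a \<or> z = b"
      and D: "vertex_deleted G x = \<lparr>verts = verts G - {x, nbr G x}, edges = add_mset (Upair a b) F\<rparr>"
      and "\<forall>v. v \<noteq> x \<and> v \<noteq> nbr G x \<longrightarrow> degree (vertex_deleted G x) v = degree G v"
      and nbrD: "\<forall>z\<in>X - {x}. nbr (vertex_deleted G x) z = (if z = a then b else if z = b then a else nbr G z)"
      by (rule G.cubic_leaf_deletion[OF x(1) Gx(2)])
    have "x' = a \<or> x' = b"
      using G.adjacent_nbr[OF x(2)] adj x(3) Gx(1) by (simp add: adjacent_sym)
    then show ?thesis
    proof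
      assume "x' = a"
      then show ?thesis using edges F dist D nbrD x by (intro exI[of _ F] exI[of _ b]) auto
    next
      assume xb: "x' = b"
      have "Upair a b = Upair b a" by simp
      then show ?thesis using xb edges F dist D nbrD x
        by (intro exI[of _ F] exI[of _ a]) (auto simp: add_mset_commute)
    qed
  qed
  interpret N: phylo X N by fact
  interpret T: phylo X T by fact
  let ?r = "nbr N x" and ?p = "nbr T x"
  obtain FN c where edgesN: "edges N = FN + {#Upair ?r x, Upair ?r x', Upair ?r c#}"
    and FN: "\<forall>e\<in>#FN. ?r \<notin> set_uprod e \<and> x \<notin> set_uprod e" and c: "c \<noteq> x" "c \<noteq> ?r"
    and DN: "vertex_deleted N x = \<lparr>verts = verts N - {x, ?r}, edges = add_mset (Upair x' c) FN\<rparr>"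
    and nbrN: "nbr (vertex_deleted N x) x' = c"
    using cherry_split[OF N Nx] by blast
  obtain FT d where edgesT: "edges T = FT + {#Upair ?p x, Upair ?p x', Upair ?p d#}"
    and FT: "\<forall>e\<in>#FT. ?p \<notin> set_uprod e \<and> x \<notin> set_uprod e" and d: "d \<noteq> x" "d \<noteq> ?p"
    and DT: "vertex_deleted T x = \<lparr>verts = verts T - {x, ?p}, edges = add_mset (Upair x' d) FT\<rparr>"
    and nbrT: "nbr (vertex_deleted T x) x' = d"
    using cherry_split[OF T Tx] by blast
  obtain f where f: "graph_iso f (vertex_deleted N x) (vertex_deleted T x)" "\<forall>y\<in>X - {x}. f y = y"
    using eq by (auto simp: equivalent_iff_graph_iso)
  have fc: "f c = d"
    using graph_iso_nbr[OF phylo_vertex_deleted[OF N x(1) card] phylo_vertex_deleted[OF T x(1) card]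
        f, of x'] x nbrN nbrT by auto
  have fx': "f x' = x'" using f(2) x by simp
  have fF: "image_mset (map_uprod f) FN = FT"
    using f(1) fc fx' by (simp add: graph_iso_def DN DT)
  have rp: "?r \<noteq> x" "?p \<noteq> x" "?r \<notin> X" "?p \<notin> X" "?r \<in> verts N" "?p \<in> verts T"
    using x(1) N.nbr_neq T.nbr_neq N.nbr_not_leaf T.nbr_not_leaf N.nbr_verts T.nbr_verts by auto
  let ?g = "f(x := x, ?r := ?p)"
  have "bij_betw f (verts N - {x, ?r}) (verts T - {x, ?p})" using f(1) by (simp add: graph_iso_def DN DT)
  then have "bij_betw ?g (verts N - {x, ?r}) (verts T - {x, ?p})"
    using bij_betw_cong[of "verts N - {x, ?r}" ?g f] by simp
  moreover have "bij_betw ?g {x, ?r} {x, ?p}" using rp by (auto simp: bij_betw_def)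
  ultimately have "bij_betw ?g ((verts N - {x, ?r}) \<union> {x, ?r}) ((verts T - {x, ?p}) \<union> {x, ?p})"
    by (rule bij_betw_combine) auto
  moreover have "(verts N - {x, ?r}) \<union> {x, ?r} = verts N" "(verts T - {x, ?p}) \<union> {x, ?p} = verts T"
    using rp x N.X_subset_verts T.X_subset_verts by auto
  ultimately have bij: "bij_betw ?g (verts N) (verts T)" by simp
  have "image_mset (map_uprod ?g) FN = image_mset (map_uprod f) FN"
    by (rule image_mset_map_uprod_cong) (use FN in auto)
  moreover have "?g x' = x'" "?g c = d" "?g ?r = ?p" "?g x = x"
    using rp x fx' fc c by auto
  ultimately have "image_mset (map_uprod ?g) (edges N) = edges T"
    using fF by (simp add: edgesN edgesT del: fun_upd_apply)
  moreover have "\<forall>y\<in>X. ?g y = y" using f(2) rp by auto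
  ultimately show ?thesis using bij unfolding equivalent_def by blast
qed


section \<open>Attaching a leaf to a pendant edge\<close>

text \<open>The pendant edge at the leaf \<open>y\<close> is subdivided by \<open>w\<close>, which also receives the leaf \<open>x\<close>.\<close>

definition attach_leaf :: "'v mgraph \<Rightarrow> 'v \<Rightarrow> 'v \<Rightarrow> 'v \<Rightarrow> 'v mgraph" where
  "attach_leaf S x y w = \<lparr>verts = verts S \<union> {x, w},
     edges = {#e \<in># edges S. y \<notin> set_uprod e#} + {#Upair w x, Upair w y, Upair w (nbr S y)#}\<rparr>"

lemma attach_leaf_phylogenetic:
  assumes S: "phylo Y S" and y: "y \<in> Y" and new: "x \<notin> verts S" "w \<notin> verts S" "x \<noteq> w"
  shows "phylogenetic_tree (insert x Y) (attach_leaf S x y w)" (is "phylogenetic_tree _ ?A")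
proof -
  interpret S: phylo Y S by fact
  let ?q = "nbr S y" and ?F = "{#e \<in># edges S. y \<notin> set_uprod e#}"
  have eS: "edges S = add_mset (Upair y ?q) ?F" by (rule S.leaf_edges[OF y])
  have yq: "y \<in> verts S" "?q \<in> verts S" "?q \<noteq> y"
    using y S.X_subset_verts S.nbr_verts S.nbr_neq by auto
  have wfA: "wf_mgraph ?A"
    using S.wf yq by (auto simp: wf_mgraph_def attach_leaf_def)
  have "tree ?A"
  proof (rule treeI_size[OF wfA])
    have adj: "adjacent ?A w x" "adjacent ?A w y" "adjacent ?A w ?q" "adjacent ?A y w"
      by (auto simp: adjacent_def attach_leaf_def)
    show "connected_graph ?A"
    proof (rule connected_graphI_root)
      show "y \<in> verts ?A" using yq by (simp add: attach_leaf_def)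
      fix v assume "v \<in> verts ?A"
      then consider "v \<in> verts S" | "v = x" | "v = w" by (auto simp: attach_leaf_def)
      then show "(adjacent ?A)\<^sup>*\<^sup>* y v"
      proof cases
        case 1
        then have "(adjacent S)\<^sup>*\<^sup>* y v" using S.connected yq by (simp add: connected_graph_def)
        then show ?thesis
        proof (rule rtranclp_adjacent_map[where \<pi> = "\<lambda>v. v"])
          fix s t assume "adjacent S s t"
          then have "Upair s t = Upair y ?q \<or> Upair s t \<in># ?F" unfolding adjacent_def
            by (subst (asm) eS) auto
          then show "(adjacent ?A)\<^sup>*\<^sup>* s t"
          proof
            assume st: "Upair s t = Upair y ?q"
            have "(adjacent ?A)\<^sup>*\<^sup>* y ?q" using adj by (meson converse_rtranclp_into_rtranclp r_into_rtranclp)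
            then show ?thesis using st adjacent_rtranclp_sym by auto
          qed (auto simp: adjacent_def attach_leaf_def)
        qed
      qed (use adj in \<open>auto intro: converse_rtranclp_into_rtranclp r_into_rtranclp\<close>)
    qed
    have "size (edges S) = Suc (size ?F)" by (subst eS) simp
    moreover have "card (verts ?A) = card (verts S) + 2"
      using new S.finite_verts by (simp add: attach_leaf_def)
    ultimately show "size (edges ?A) + 1 = card (verts ?A)"
      using tree_size[OF S.is_tree] by (simp add: attach_leaf_def)
  qed
  have F0: "edge_degree ?F v = 0" if "v \<notin> verts S" for v
    by (rule edge_degree_eq_0) (use that S.wf in \<open>auto simp: wf_mgraph_def\<close>)
  have degx: "degree ?A x = 1"
    using F0[OF new(1)] new yq by (auto simp: degree_eq_edge_degree attach_leaf_def)
  have degw: "degree ?A w = 3"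
    using F0[OF new(2)] new yq by (auto simp: degree_eq_edge_degree attach_leaf_def)
  have deg: "degree ?A v = degree S v" if v: "v \<in> verts S" for v
  proof -
    have "edge_degree (edges S) v = (if y = v then 1 else 0) + (if ?q = v then 1 else 0) + edge_degree ?F v"
      by (subst eS) simp
    moreover have "v \<noteq> x" "v \<noteq> w" using v new by auto
    ultimately show ?thesis by (simp add: degree_eq_edge_degree attach_leaf_def)
  qed
  have vA: "verts ?A = insert x (insert w (verts S))" by (auto simp: attach_leaf_def)
  have "degree ?A v \<noteq> 2" if "v \<in> verts ?A" for v
    using that degx degw deg S.degree_not_2 unfolding vA by auto
  moreover have "leaves ?A = insert x Y"
    using degx degw deg S.mem_X_iff unfolding leaves_def vA by auto
  ultimately show ?thesis using \<open>tree ?A\<close> by (simp add: phylogenetic_tree_iff)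
qed

lemma attach_leaf_props:
  assumes S: "phylo Y S" and y: "y \<in> Y" and new: "x \<notin> verts S" "w \<notin> verts S" "x \<noteq> w"
  defines "A \<equiv> attach_leaf S x y w"
  shows "phylo (insert x Y) A" "nbr A x = w" "nbr A y = w" "degree A w = 3" "vertex_deleted A x = S"
proof -
  interpret S: phylo Y S by fact
  have "x \<notin> Y" using new S.X_subset_verts by auto
  moreover have "finite Y" using S.card_X card.infinite by fastforce
  ultimately show A: "phylo (insert x Y) A"
    using attach_leaf_phylogenetic[OF assms(1-5)] S.card_X unfolding A_def by unfold_locales auto
  interpret A: phylo "insert x Y" A by fact
  have "adjacent A x w" "adjacent A y w" by (auto simp: adjacent_def A_def attach_leaf_def)
  then show nbr: "nbr A x = w" "nbr A y = w" using A.adjacent_leaf_iff y by auto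
  let ?q = "nbr S y" and ?F = "{#e \<in># edges S. y \<notin> set_uprod e#}"
  have eS: "edges S = add_mset (Upair y ?q) ?F" by (rule S.leaf_edges[OF y])
  have yq: "y \<in> verts S" "?q \<in> verts S" "?q \<noteq> y"
    using y S.X_subset_verts S.nbr_verts S.nbr_neq by auto
  have F: "w \<notin> set_uprod e \<and> x \<notin> set_uprod e" if "e \<in># ?F" for e
    using that S.wf new by (auto simp: wf_mgraph_def)
  have "edge_degree ?F w = 0" by (rule edge_degree_eq_0) (use F in blast)
  then show "degree A w = 3" using new yq by (auto simp: degree_eq_edge_degree A_def attach_leaf_def)
  have "vertex_deleted A x = \<lparr>verts = verts A - {x, w}, edges = add_mset (Upair y ?q) ?F\<rparr>"
    by (rule A.vertex_deleted_cubic) (use F new yq in \<open>auto simp: A_def attach_leaf_def\<close>)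
  moreover have "verts A - {x, w} = verts S" using new by (auto simp: A_def attach_leaf_def)
  ultimately show "vertex_deleted A x = S" using eS by simp
qed


section \<open>Reconstructing a tree from two or three leaves\<close>

context phylo
begin

lemma nbr_vertex_deleted_other:
  assumes u: "u \<in> X" and z: "z \<in> X" "nbr G z \<noteq> nbr G u"
  shows "nbr (vertex_deleted G u) z = nbr G z"
    and "degree (vertex_deleted G u) (nbr G z) = degree G (nbr G z)"
proof -
  have zu: "z \<noteq> u" using z(2) by auto
  have zn: "nbr G z \<noteq> u" using nbr_not_leaf[OF z(1)] u by metis
  have "nbr (vertex_deleted G u) z = nbr G z \<and>
    degree (vertex_deleted G u) (nbr G z) = degree G (nbr G z)"
  proof (rule nbr_degree_cases[OF u])
    assume "4 \<le> degree G (nbr G u)"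
    then show ?thesis
      using nbr_vertex_deleted_high[OF u _ z(1) zu] degree_vertex_deleted_high[OF u _ zn] z(2) by simp
  next
    assume deg: "degree G (nbr G u) = 3"
    obtain F a b where "edges G = F + {#Upair (nbr G u) u, Upair (nbr G u) a, Upair (nbr G u) b#}"
      and "\<forall>e\<in>#F. nbr G u \<notin> set_uprod e \<and> u \<notin> set_uprod e"
      and "distinct [nbr G u, u, a, b]" and "a \<in> verts G" "b \<in> verts G"
      and adj: "\<forall>z. adjacent G (nbr G u) z \<longleftrightarrow> z = u \<or> z = a \<or> z = b"
      and "vertex_deleted G u = \<lparr>verts = verts G - {u, nbr G u}, edges = add_mset (Upair a b) F\<rparr>"
      and degD: "\<forall>v. v \<noteq> u \<and> v \<noteq> nbr G u \<longrightarrow> degree (vertex_deleted G u) v = degree G v"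
      and nbrD: "\<forall>z\<in>X - {u}. nbr (vertex_deleted G u) z = (if z = a then b else if z = b then a else nbr G z)"
      by (rule cubic_leaf_deletion[OF u deg])
    have "\<not> adjacent G (nbr G u) z"
      using z adjacent_leaf_iff[OF z(1)] adjacent_sym by metis
    then show ?thesis using adj nbrD degD z zu zn by auto
  qed
  then show "nbr (vertex_deleted G u) z = nbr G z"
    "degree (vertex_deleted G u) (nbr G z) = degree G (nbr G z)" by blast+
qed

lemma card_X_le_closed:
  assumes "c \<in> C" "C \<subseteq> verts G" "C \<inter> X = {}" "finite L" "L \<subseteq> X"
    and "\<And>u v. u \<in> C \<Longrightarrow> adjacent G u v \<Longrightarrow> v \<in> C \<union> L" "\<And>l. l \<in> L \<Longrightarrow> nbr G l \<in> C"
  shows "card X \<le> card L"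
proof -
  have "X \<subseteq> C \<union> L"
  proof (rule closed_set_contains_X)
    show "v \<in> C \<union> L" if "u \<in> C \<union> L" "adjacent G u v" for u v
      using that(1)
    proof
      assume "u \<in> L"
      then show ?thesis using assms(5,7) that(2) adjacent_leaf_iff by auto
    qed (use assms(6) that(2) in blast)
  qed (use assms(1,2) in auto)
  then have "X \<subseteq> L" using assms(3) by blast
  then show ?thesis using assms(4) by (rule card_mono[rotated])
qed

lemma cubic_cherry:
  assumes card: "4 \<le> card X" and u: "u \<in> X" "degree G (nbr G u) = 3"
    and z: "z \<in> X" "z \<noteq> u" "nbr G z = nbr G u"
  obtains c where "\<forall>v. adjacent G (nbr G u) v \<longleftrightarrow> v = u \<or> v = z \<or> v = c"
    "c \<notin> X" "c \<noteq> nbr G u" "c \<in> verts G"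
    "nbr (vertex_deleted G u) z = c" "nbr (vertex_deleted G z) u = c"
proof -
  have one: "\<exists>c. (\<forall>v. adjacent G (nbr G u) v \<longleftrightarrow> v = u \<or> v = z \<or> v = c) \<and> c \<noteq> u \<and> c \<noteq> z \<and>
      c \<noteq> nbr G u \<and> nbr (vertex_deleted G u) z = c"
    if u: "u \<in> X" "degree G (nbr G u) = 3" and z: "z \<in> X" "z \<noteq> u" "nbr G z = nbr G u" for u z
  proof -
    obtain F a b where "edges G = F + {#Upair (nbr G u) u, Upair (nbr G u) a, Upair (nbr G u) b#}"
      and "\<forall>e\<in>#F. nbr G u \<notin> set_uprod e \<and> u \<notin> set_uprod e"
      and dist: "distinct [nbr G u, u, a, b]" and "a \<in> verts G" "b \<in> verts G"
      and adj: "\<forall>z. adjacent G (nbr G u) z \<longleftrightarrow> z = u \<or> z = a \<or> z = b"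
      and "vertex_deleted G u = \<lparr>verts = verts G - {u, nbr G u}, edges = add_mset (Upair a b) F\<rparr>"
      and degD: "\<forall>v. v \<noteq> u \<and> v \<noteq> nbr G u \<longrightarrow> degree (vertex_deleted G u) v = degree G v"
      and nbrD: "\<forall>z\<in>X - {u}. nbr (vertex_deleted G u) z = (if z = a then b else if z = b then a else nbr G z)"
      by (rule cubic_leaf_deletion[OF u])
    have "adjacent G (nbr G u) z" using adjacent_nbr[OF z(1)] z(3) by (simp add: adjacent_sym)
    then have "z = a \<or> z = b" using adj z(2) by blast
    then show ?thesis
    proof
      assume "z = a"
      then show ?thesis using adj dist nbrD z by (intro exI[of _ b]) auto
    next
      assume "z = b"
      then show ?thesis using adj dist nbrD z by (intro exI[of _ a]) auto
    qed
  qed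
  obtain c where c: "\<forall>v. adjacent G (nbr G u) v \<longleftrightarrow> v = u \<or> v = z \<or> v = c" "c \<noteq> u" "c \<noteq> z"
    "c \<noteq> nbr G u" "nbr (vertex_deleted G u) z = c"
    using one[OF u z] by blast
  obtain c' where c': "\<forall>v. adjacent G (nbr G u) v \<longleftrightarrow> v = z \<or> v = u \<or> v = c'" "c' \<noteq> u" "c' \<noteq> z"
    "nbr (vertex_deleted G z) u = c'"
    using one[of z u] u z(1) z(2)[symmetric] z(3)[symmetric] unfolding z(3) by blast
  have "adjacent G (nbr G u) c" using c(1) by simp
  then have "c' = c" using c(2,3) c'(1) by simp
  have cv: "c \<in> verts G" using c(1) wf_adjacent_verts[OF wf] by blast
  have "c \<notin> X"
  proof
    assume cX: "c \<in> X"
    have "adjacent G c (nbr G u)" using c(1) adjacent_sym by metis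
    then have "nbr G c = nbr G u" using adjacent_leaf_iff[OF cX] by simp
    then have "card X \<le> card {u, z, c}"
      by (intro card_X_le_closed[of "nbr G u" "{nbr G u}"])
        (use u z c(1) cX nbr_verts[OF u(1)] nbr_not_leaf[OF u(1)] in auto)
    also have "\<dots> \<le> 3" by (simp add: card_insert_if)
    finally show False using card by simp
  qed
  then show ?thesis using that[OF c(1) _ c(4) cv c(5)] c'(4) \<open>c' = c\<close> by simp
qed

end

lemma common_nbr_of_two_deletions:
  assumes N: "phylo X N" and T: "phylo X T" and card: "5 \<le> card X"
    and mem: "x \<in> X" "x' \<in> X" "y \<in> X" "y' \<in> X" and neq: "x \<noteq> x'" "y \<noteq> y'"
    and Tp: "nbr T x = nbr T x'" "nbr T y = nbr T y'" "nbr T x \<noteq> nbr T y"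
    and eqx: "equivalent (X - {x}) (vertex_deleted N x) (vertex_deleted T x)"
    and eqy: "equivalent (X - {y}) (vertex_deleted N y) (vertex_deleted T y)"
  shows "nbr N x = nbr N x' \<and> (degree N (nbr N x) = 3 \<longleftrightarrow> degree T (nbr T x) = 3)"
proof -
  interpret N: phylo X N by fact
  interpret T: phylo X T by fact
  have card4: "4 \<le> card X" using card by simp
  let ?Nx = "vertex_deleted N x" and ?Ny = "vertex_deleted N y"
  let ?Tx = "vertex_deleted T x" and ?Ty = "vertex_deleted T y"
  let ?r = "nbr N x" and ?r' = "nbr N x'" and ?s = "nbr N y" and ?d = "degree T (nbr T x)"
  have dist: "x \<noteq> y" "x \<noteq> y'" "x' \<noteq> y" "x' \<noteq> y'" using Tp by auto
  note nbr_x = equivalent_nbr[OF phylo_vertex_deleted[OF N mem(1) card4]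
      phylo_vertex_deleted[OF T mem(1) card4] eqx]
  note nbr_y = equivalent_nbr[OF phylo_vertex_deleted[OF N mem(3) card4]
      phylo_vertex_deleted[OF T mem(3) card4] eqy]
  have Ty: "nbr ?Ty x = nbr T x" "nbr ?Ty x' = nbr T x" "degree ?Ty (nbr T x) = ?d"
    using T.nbr_vertex_deleted_other[OF mem(3,1)] T.nbr_vertex_deleted_other[OF mem(3,2)] Tp by auto
  have Tx: "nbr ?Tx y = nbr T y" "nbr ?Tx y' = nbr T y"
    using T.nbr_vertex_deleted_other[OF mem(1,3)] T.nbr_vertex_deleted_other[OF mem(1,4)] Tp by auto
  have Ny: "nbr ?Ny x = nbr ?Ny x'" "degree ?Ny (nbr ?Ny x) = ?d"
    using nbr_y(1)[of x] nbr_y(2)[of x x'] Ty mem dist by auto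
  have Nx: "nbr ?Nx y = nbr ?Nx y'" using nbr_x(2)[of y y'] Tx mem dist by auto
  have d3: "?d = 3" if "nbr ?Nx y = nbr ?Nx x'"
  proof (rule T.nbr_degree_cases[OF mem(1)])
    assume "4 \<le> ?d"
    then have "nbr ?Tx x' = nbr T x" using T.nbr_vertex_deleted_high mem neq Tp by auto
    moreover have "nbr ?Tx y = nbr ?Tx x'" using nbr_x(2)[of y x'] that mem dist neq by auto
    ultimately show ?thesis using Tx(1) Tp(3) by simp
  qed
  have card_le: "card {x, x', y, y'} \<le> 4" by (simp add: card_insert_if)
  have noleaf: "?r \<notin> X" "?r' \<notin> X" "?s \<notin> X" using N.nbr_not_leaf mem by auto
  have adj_nbr: "adjacent N (nbr N z) z" if "z \<in> X" for z
    using N.adjacent_nbr[OF that] adjacent_sym by metis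
  \<comment> \<open>If \<open>y\<close> has a neighbour in common with \<open>x\<close> or \<open>x'\<close>, then either the claim still holds or
    the interior vertices found so far are closed under adjacency up to the four given leaves.\<close>
  consider "?r \<noteq> ?s" "?r' \<noteq> ?s" | "4 \<le> degree N ?s" "?r = ?s \<or> ?r' = ?s"
    | "degree N ?s = 3" "?r = ?s" | "degree N ?s = 3" "?r \<noteq> ?s" "?r' = ?s"
    using N.nbr_degree[OF mem(3)] by linarith
  then show ?thesis
  proof cases
    case 1
    then show ?thesis
      using N.nbr_vertex_deleted_other[OF mem(3,1)] N.nbr_vertex_deleted_other[OF mem(3,2)] Ny by simp
  next
    case 2
    then have "?r = ?r'"
      using N.nbr_vertex_deleted_high[OF mem(3) 2(1)] Ny(1) mem dist by simp
    then have r: "?r = ?s" "?r' = ?s" using 2(2) by auto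
    have "?d = degree N ?r - 1"
      using N.nbr_vertex_deleted_high[OF mem(3) 2(1) mem(1)] Ny(2) dist r
        N.degree_vertex_deleted_high[OF mem(3) 2(1), of ?s] N.nbr_neq[OF mem(3)] by simp
    moreover have "?d \<noteq> 3"
    proof
      assume "?d = 3"
      then have deg: "degree N ?s = 4" using calculation r 2(1) by simp
      then have "nbr N y' = ?s"
        using N.nbr_vertex_deleted_high[OF mem(1)] r Nx mem dist by simp
      then have nb: "nbr N l = ?s" if "l \<in> {x, x', y, y'}" for l using that r by auto
      have sub: "{x, x', y, y'} \<subseteq> {z. adjacent N ?s z}"
        using nb adj_nbr mem by fastforce
      have "card {x, x', y, y'} = 4" using neq dist by simp
      then have all: "v \<in> {x, x', y, y'}" if "adjacent N ?s v" for v
        using N.all_neighbours[OF sub _ that] deg by simp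
      have "card X \<le> card {x, x', y, y'}"
      proof (rule N.card_X_le_closed[of ?s "{?s}"])
        show "v \<in> {?s} \<union> {x, x', y, y'}" if "u \<in> {?s}" "adjacent N u v" for u v
          using all that by blast
        show "nbr N l \<in> {?s}" if "l \<in> {x, x', y, y'}" for l using nb[OF that] by simp
      qed (use mem noleaf N.nbr_verts in auto)
      then show False using card card_le by simp
    qed
    ultimately show ?thesis using r 2(1) by auto
  next
    case 3
    obtain c where c: "\<forall>v. adjacent N ?s v \<longleftrightarrow> v = y \<or> v = x \<or> v = c"
      "c \<notin> X" "c \<noteq> ?s" "c \<in> verts N" "nbr ?Ny x = c" "nbr ?Nx y = c"
      by (rule N.cubic_cherry[OF card4 mem(3) 3(1) mem(1) dist(1) 3(2)])
    have r': "?r' \<noteq> ?s" using c(1,2) adj_nbr[OF mem(2)] mem dist neq by metis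
    then have x'c: "?r' = c" "nbr ?Nx x' = c"
      using N.nbr_vertex_deleted_other[OF mem(3,2)] N.nbr_vertex_deleted_other[OF mem(1,2)] Ny(1) c(5) 3(2)
      by auto
    have "?d = 3" using d3 c(6) x'c(2) by simp
    then have "degree N c = 3"
      using N.nbr_vertex_deleted_other[OF mem(3,2) r'] Ny c(5) x'c(1) by simp
    have "nbr N y' \<noteq> ?s" using c(1,2) adj_nbr[OF mem(4)] mem dist neq by metis
    then have y'c: "nbr N y' = c"
      using N.nbr_vertex_deleted_other[OF mem(1,4)] Nx c(6) 3(2) by simp
    have "adjacent N c ?s" using c(1) adjacent_sym by metis
    then have sub: "{?s, x', y'} \<subseteq> {z. adjacent N c z}"
      using adj_nbr[OF mem(2)] adj_nbr[OF mem(4)] x'c y'c by auto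
    moreover have "card {?s, x', y'} = 3" using noleaf mem dist by (auto simp: card_insert_if)
    ultimately have all: "v \<in> {?s, x', y'}" if "adjacent N c v" for v
      using N.all_neighbours[OF sub _ that] \<open>degree N c = 3\<close> by simp
    have "card X \<le> card {x, x', y, y'}"
    proof (rule N.card_X_le_closed[of ?s "{?s, c}"])
      show "v \<in> {?s, c} \<union> {x, x', y, y'}" if "u \<in> {?s, c}" "adjacent N u v" for u v
        using all[of v] that c(1) by blast
      show "nbr N l \<in> {?s, c}" if "l \<in> {x, x', y, y'}" for l using that 3(2) x'c y'c by auto
    qed (use mem noleaf c N.nbr_verts in auto)
    then show ?thesis using card card_le by simp
  next
    case 4
    obtain c where c: "\<forall>v. adjacent N ?s v \<longleftrightarrow> v = y \<or> v = x' \<or> v = c"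
      "c \<notin> X" "c \<noteq> ?s" "c \<in> verts N" "nbr ?Ny x' = c" "nbr (vertex_deleted N x') y = c"
      by (rule N.cubic_cherry[OF card4 mem(3) 4(1) mem(2) dist(3) 4(3)])
    have rc: "?r = c" using N.nbr_vertex_deleted_other[OF mem(3,1) 4(2)] Ny(1) c(5) by simp
    have "nbr ?Nx y = ?s" using N.nbr_vertex_deleted_other[OF mem(1,3)] 4(2) by simp
    then have y's: "nbr ?Nx y' = ?s" using Nx by simp
    have "nbr N y' \<noteq> ?s" using c(1,2) adj_nbr[OF mem(4)] mem dist neq by metis
    then have y'c: "nbr N y' = c"
      using N.nbr_vertex_deleted_other[OF mem(1,4)] y's rc by auto
    have "degree N c = 3"
    proof (rule N.nbr_degree_cases[OF mem(1)])
      assume "4 \<le> degree N ?r"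
      then show ?thesis
        using N.nbr_vertex_deleted_high[OF mem(1) _ mem(4)] y's y'c c(3) dist by simp
    qed (use rc in simp)
    have "adjacent N c ?s" using c(1) adjacent_sym by metis
    then have sub: "{?s, x, y'} \<subseteq> {z. adjacent N c z}"
      using adj_nbr[OF mem(1)] adj_nbr[OF mem(4)] rc y'c by auto
    moreover have "card {?s, x, y'} = 3" using noleaf mem dist by (auto simp: card_insert_if)
    ultimately have all: "v \<in> {?s, x, y'}" if "adjacent N c v" for v
      using N.all_neighbours[OF sub _ that] \<open>degree N c = 3\<close> by simp
    have "card X \<le> card {x, x', y, y'}"
    proof (rule N.card_X_le_closed[of ?s "{?s, c}"])
      show "v \<in> {?s, c} \<union> {x, x', y, y'}" if "u \<in> {?s, c}" "adjacent N u v" for u v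
        using all[of v] that c(1) by blast
      show "nbr N l \<in> {?s, c}" if "l \<in> {x, x', y, y'}" for l using that 4(3) rc y'c by auto
    qed (use mem noleaf c N.nbr_verts in auto)
    then show ?thesis using card card_le by simp
  qed
qed


lemma card_pos_obtains:
  assumes "0 < card A"
  obtains a where "a \<in> A"
  using assms by (metis all_not_in_conv card.empty less_irrefl)

context phylo
begin

lemma not_star_interior_neighbour:
  assumes "\<not> star G" "v \<in> verts G" "v \<notin> X"
  shows "\<exists>w\<in>verts G - X. adjacent G v w"
proof (rule ccontr)
  assume no: "\<not> ?thesis"
  have leaf: "z \<in> X \<and> nbr G z = v" if "adjacent G v z" for z
  proof -
    have "z \<in> X" using no that wf_adjacent_verts[OF wf that] by blast
    then show ?thesis using that adjacent_leaf_iff adjacent_sym by metis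
  qed
  have "verts G \<subseteq> insert v {z \<in> X. nbr G z = v}"
  proof (rule connected_closed_set[OF connected _ assms(2)])
    show "t \<in> insert v {z \<in> X. nbr G z = v}"
      if "s \<in> insert v {z \<in> X. nbr G z = v}" "adjacent G s t" for s t
      using that leaf[of t] adjacent_leaf_iff[of s t] by auto
  qed simp
  then have "\<And>u. u \<in> verts G \<and> u \<notin> leaves G \<longleftrightarrow> u = v"
    using assms(2,3) phylogenetic by (auto simp: phylogenetic_tree_iff)
  then have "star G" unfolding star_def by simp
  then show False using assms(1) by blast
qed

lemma two_leaves_at:
  assumes p: "p \<in> verts G" "p \<notin> X" and w: "adjacent G p w"
    and pendant: "\<forall>z\<in>verts G - X. adjacent G p z \<longrightarrow> z = w"
  shows "\<exists>x\<in>X. \<exists>x'\<in>X. x \<noteq> x' \<and> nbr G x = p \<and> nbr G x' = p"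
proof -
  let ?A = "{z. adjacent G p z}"
  have "degree G p \<noteq> 0" using simple_degree_card[OF simple, of p] w by auto
  moreover have "degree G p \<noteq> 1" "degree G p \<noteq> 2" using p degree_not_2 by (auto simp: mem_X_iff)
  ultimately have "3 \<le> card ?A" using simple_degree_card(2)[OF simple, of p] by linarith
  then have "2 \<le> card (?A - {w})" using w simple_degree_card(1)[OF simple, of p] by simp
  then obtain x x' where x: "x \<in> ?A - {w}" "x' \<in> ?A - {w}" "x \<noteq> x'"
    using card_le_Suc0_iff_eq[of "?A - {w}"] simple_degree_card(1)[OF simple, of p] by force
  have "z \<in> X \<and> nbr G z = p" if z: "z \<in> ?A - {w}" for z
  proof -
    have "z \<in> X" using z pendant wf_adjacent_verts[OF wf, of p z] by blast
    then show ?thesis using z adjacent_leaf_iff adjacent_sym by (metis DiffD1 mem_Collect_eq)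
  qed
  then show ?thesis using x by blast
qed

lemma not_star_two_leaf_pairs:
  assumes "\<not> star G"
  obtains x x' y y' where "x \<in> X" "x' \<in> X" "y \<in> X" "y' \<in> X" "x \<noteq> x'" "y \<noteq> y'"
    "nbr G x = nbr G x'" "nbr G y = nbr G y'" "nbr G x \<noteq> nbr G y"
proof -
  let ?I = "verts G - X"
  have pendant: "\<exists>u\<in>?I. u \<noteq> v \<and> (\<exists>w\<in>?I. adjacent G u w \<and> (\<forall>z\<in>?I. adjacent G u z \<longrightarrow> z = w))"
    if v: "v \<in> ?I" for v
  proof -
    obtain w where w: "w \<in> ?I" "adjacent G v w"
      using not_star_interior_neighbour[OF assms] v by blast
    show ?thesis by (rule acyclic_pendant_vertex[OF wf acyclic _ v w]) auto
  qed
  have "0 < card X" using card_X by simp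
  then obtain x0 where x0: "x0 \<in> X" by (rule card_pos_obtains)
  then have "nbr G x0 \<in> ?I" using nbr_verts nbr_not_leaf by blast
  then obtain p wp where p: "p \<in> ?I" "adjacent G p wp" "\<forall>z\<in>?I. adjacent G p z \<longrightarrow> z = wp"
    using pendant by meson
  obtain q wq where q: "q \<in> ?I" "q \<noteq> p" "adjacent G q wq" "\<forall>z\<in>?I. adjacent G q z \<longrightarrow> z = wq"
    using pendant[OF p(1)] by meson
  obtain x x' where x: "x \<in> X" "x' \<in> X" "x \<noteq> x'" "nbr G x = p" "nbr G x' = p"
    using two_leaves_at[OF _ _ p(2,3)] p(1) by blast
  obtain y y' where "y \<in> X" "y' \<in> X" "y \<noteq> y'" "nbr G y = q" "nbr G y' = q"
    using two_leaves_at[OF _ _ q(3,4)] q(1) by blast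
  then show ?thesis using that[of x x' y y'] x q(2) by simp
qed

lemma star_nbr:
  assumes "star G" "x \<in> X" "z \<in> X"
  shows "nbr G x = nbr G z"
proof -
  have "leaves G = X" using phylogenetic by (simp add: phylogenetic_tree_iff)
  then have "nbr G u \<in> verts G \<and> nbr G u \<notin> leaves G" if "u \<in> X" for u
    using that nbr_verts nbr_not_leaf by simp
  then show ?thesis using assms unfolding star_def by blast
qed

lemma nbr_degree_ge_card:
  assumes "A \<subseteq> X" "\<And>z. z \<in> A \<Longrightarrow> nbr G z = m"
  shows "card A \<le> degree G m"
proof (rule degree_ge_card)
  show "A \<subseteq> {z. adjacent G m z}"
    using assms adjacent_nbr adjacent_sym by (metis mem_Collect_eq subsetD subsetI)
qed

lemma finite_X: "finite X"
  using card_X card.infinite by fastforce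

lemma star_degree:
  assumes "star G" "x \<in> X"
  shows "card X \<le> degree G (nbr G x)"
  by (rule nbr_degree_ge_card[OF order_refl]) (rule star_nbr[OF assms(1) _ assms(2)])

end

lemma equivalent_star_if_three_deletions:
  assumes N: "phylo X N" and T: "phylo X T" and card: "5 \<le> card X" and star: "star T"
    and U: "U \<subseteq> X" "card U = 3"
    and eq: "\<And>u. u \<in> U \<Longrightarrow> equivalent (X - {u}) (vertex_deleted N u) (vertex_deleted T u)"
  shows "equivalent X N T"
proof -
  interpret N: phylo X N by fact
  interpret T: phylo X T by fact
  have card4: "4 \<le> card X" using card by simp
  have finU: "finite U" using U card.infinite by fastforce
  have Tdeg: "4 \<le> degree T (nbr T u)" if "u \<in> X" for u
    using T.star_degree[OF star that] card by simp
  have same: "nbr (vertex_deleted N u) z = nbr (vertex_deleted N u) t"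
    if u: "u \<in> U" and zt: "z \<in> X - {u}" "t \<in> X - {u}" for u z t
  proof -
    have uX: "u \<in> X" using u U by auto
    have "nbr (vertex_deleted T u) z = nbr (vertex_deleted T u) t"
      using T.nbr_vertex_deleted_high[OF uX Tdeg[OF uX], of z] zt
        T.nbr_vertex_deleted_high[OF uX Tdeg[OF uX], of t] T.star_nbr[OF star, of z t] by simp
    moreover have "nbr (vertex_deleted T u) z = nbr (vertex_deleted T u) t \<longleftrightarrow>
        nbr (vertex_deleted N u) z = nbr (vertex_deleted N u) t"
      by (rule equivalent_nbr(2)[OF phylo_vertex_deleted[OF N uX card4]
          phylo_vertex_deleted[OF T uX card4] eq[OF u] zt])
    ultimately show ?thesis by (rule iffD1[rotated])
  qed
  have "\<exists>u\<in>U. 4 \<le> degree N (nbr N u)"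
  proof (rule ccontr)
    assume no: "\<not> ?thesis"
    have deg3: "degree N (nbr N u) = 3" if "u \<in> U" for u
      using no that N.nbr_degree U by fastforce
    have "0 < card U" using U(2) by simp
    then obtain a where a: "a \<in> U" by (rule card_pos_obtains)
    then have aX: "a \<in> X" using U by auto
    let ?s = "nbr N a" and ?D = "vertex_deleted N a"
    have card_Xa: "card (X - {a}) = card X - 1" using aX N.finite_X by simp
    have card_Ua: "card (U - {a}) = 2" using a finU U(2) by simp
    show False
    proof (cases "\<exists>z\<in>X - {a}. nbr N z = ?s")
      case True
      then obtain z where z: "z \<in> X" "z \<noteq> a" "nbr N z = ?s" by blast
      obtain c where c: "\<forall>v. adjacent N ?s v \<longleftrightarrow> v = a \<or> v = z \<or> v = c"
        "c \<notin> X" "c \<noteq> ?s" "c \<in> verts N" "nbr ?D z = c" "nbr (vertex_deleted N z) a = c"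
        by (rule N.cubic_cherry[OF card4 aX deg3[OF a] z])
      have tc: "nbr N t = c" if t: "t \<in> X - {a, z}" for t
      proof -
        have "nbr N t \<noteq> ?s" using t c(1,2) N.adjacent_nbr adjacent_sym by (metis Diff_iff insert_iff)
        then have "nbr ?D t = nbr N t" using N.nbr_vertex_deleted_other[OF aX] t by blast
        then show ?thesis using same[OF a, of z t] z t c(5) by auto
      qed
      have "0 < card (U - {a} - {z})" using card_Ua finU by (simp add: card_Diff_singleton_if)
      then obtain t where t: "t \<in> U - {a} - {z}" by (rule card_pos_obtains)
      then have "degree N c = 3" using deg3[of t] tc[of t] U by auto
      have "insert ?s (X - {a, z}) \<subseteq> {v. adjacent N c v}"
      proof
        fix v assume "v \<in> insert ?s (X - {a, z})"
        then show "v \<in> {v. adjacent N c v}"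
          using c(1) tc N.adjacent_nbr adjacent_sym by (metis DiffD1 insertE mem_Collect_eq)
      qed
      then have "card (insert ?s (X - {a, z})) \<le> 3" using N.degree_ge_card \<open>degree N c = 3\<close> by metis
      moreover have "card (X - {a, z}) = card X - 2" using aX z by (simp add: card_Diff_subset)
      ultimately show False using card N.finite_X N.nbr_not_leaf[OF aX] by simp
    next
      case False
      obtain b where b: "b \<in> U - {a}" by (rule card_pos_obtains[of "U - {a}"]) (use card_Ua in auto)
      have "nbr N z = nbr N b" if z: "z \<in> X - {a}" for z
      proof -
        have "nbr N z = nbr ?D z" "nbr N b = nbr ?D b"
          using False N.nbr_vertex_deleted_other(1)[OF aX] z b U by auto
        then show ?thesis using same[OF a z, of b] b U by auto
      qed
      then have "card (X - {a}) \<le> degree N (nbr N b)" using N.nbr_degree_ge_card by blast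
      then show False using deg3[of b] b card card_Xa by simp
    qed
  qed
  then obtain u where u: "u \<in> U" "4 \<le> degree N (nbr N u)" by blast
  then have uX: "u \<in> X" using U by auto
  have "card (U - {u}) = 2" using u finU U(2) by simp
  then have "0 < card (U - {u})" by simp
  then obtain b where "b \<in> U - {u}" by (rule card_pos_obtains)
  then have b: "b \<in> U" "b \<noteq> u" by auto
  then have bX: "b \<in> X" using U by auto
  have all: "nbr N z = nbr N b" if z: "z \<in> X - {u}" for z
    using same[OF u(1) z, of b] bX b N.nbr_vertex_deleted_high[OF uX u(2)] z by auto
  then have "card (X - {u}) \<le> degree N (nbr N b)" using N.nbr_degree_ge_card by blast
  then have degb: "4 \<le> degree N (nbr N b)" using uX N.finite_X card by simp
  have "card (X - {u, b}) = card X - 2" using uX bX b by (simp add: card_Diff_subset)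
  then have "0 < card (X - {u, b})" using card by simp
  then obtain z where z: "z \<in> X - {u, b}" by (rule card_pos_obtains)
  have "nbr N u = nbr N z"
    using same[OF b(1), of u z] uX b z N.nbr_vertex_deleted_high[OF bX degb] by auto
  then show ?thesis
    using extend_equivalent_high[OF N T card4 uX _ _ _ u(2) T.star_nbr[OF star uX] Tdeg[OF uX] eq[OF u(1)], of z]
      z by auto
qed

lemma equivalent_if_two_deletions:
  assumes N: "phylo X N" and T: "phylo X T" and card: "5 \<le> card X"
    and mem: "x \<in> X" "x' \<in> X" "y \<in> X" "y' \<in> X" and neq: "x \<noteq> x'" "y \<noteq> y'"
    and Tp: "nbr T x = nbr T x'" "nbr T y = nbr T y'" "nbr T x \<noteq> nbr T y"
    and eqx: "equivalent (X - {x}) (vertex_deleted N x) (vertex_deleted T x)"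
    and eqy: "equivalent (X - {y}) (vertex_deleted N y) (vertex_deleted T y)"
  shows "equivalent X N T"
proof -
  interpret N: phylo X N by fact
  interpret T: phylo X T by fact
  have card4: "4 \<le> card X" using card by simp
  have Nx: "nbr N x = nbr N x'" "degree N (nbr N x) = 3 \<longleftrightarrow> degree T (nbr T x) = 3"
    using common_nbr_of_two_deletions[OF assms] by auto
  show ?thesis
  proof (rule T.nbr_degree_cases[OF mem(1)])
    assume deg: "degree T (nbr T x) = 3"
    then show ?thesis
      using extend_equivalent_cubic[OF N T card4 mem(1,2) neq(1) Nx(1) _ Tp(1) deg eqx] Nx(2) by simp
  next
    assume deg: "4 \<le> degree T (nbr T x)"
    then have "4 \<le> degree N (nbr N x)" using Nx(2) N.nbr_degree[OF mem(1)] by linarith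
    then show ?thesis
      using extend_equivalent_high[OF N T card4 mem(1,2) neq(1) Nx(1) _ Tp(1) deg eqx] by simp
  qed
qed


section \<open>Too few leaves\<close>

lemma verts_vertex_deleted:
  assumes "phylo X G" "x \<in> X"
  shows "verts (vertex_deleted G x) \<subseteq> verts G - {x}"
proof -
  interpret phylo X G by fact
  show ?thesis
  proof (rule nbr_degree_cases[OF assms(2)])
    assume deg: "degree G (nbr G x) = 3"
    show ?thesis by (rule cubic_leaf_deletion[OF assms(2) deg]) auto
  qed (simp add: vertex_deleted_high[OF assms(2)])
qed

lemma phylo_network: "phylo X N \<Longrightarrow> phylogenetic_network X N"
  using tree_phylogenetic_network_iff phylo.is_tree phylo.phylogenetic by blast

lemma attach_leaf_vertex_deleted:
  assumes T: "phylo X T" and card: "4 \<le> card X" and xy: "x \<in> X" "y \<in> X" "x \<noteq> y"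
    and w: "w \<notin> verts T"
  defines "N \<equiv> attach_leaf (vertex_deleted T x) x y w"
  shows "phylo X N" "nbr N x = nbr N y" "degree N (nbr N x) = 3"
    "vertex_deleted N x = vertex_deleted T x"
proof -
  interpret T: phylo X T by fact
  have S: "phylo (X - {x}) (vertex_deleted T x)" by (rule phylo_vertex_deleted[OF T xy(1) card])
  have new: "x \<notin> verts (vertex_deleted T x)" "w \<notin> verts (vertex_deleted T x)" "x \<noteq> w"
    using verts_vertex_deleted[OF T xy(1)] w T.X_subset_verts xy(1) by auto
  have y: "y \<in> X - {x}" using xy by simp
  note props = attach_leaf_props[OF S y new, folded N_def]
  have "insert x (X - {x}) = X" using xy(1) by auto
  then show "phylo X N" using props(1) by simp
  show "nbr N x = nbr N y" "degree N (nbr N x) = 3" "vertex_deleted N x = vertex_deleted T x"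
    using props by simp_all
qed

lemma not_reconstructible_from_one:
  fixes T :: "'v::infinite mgraph"
  assumes T: "phylo X T" and card: "5 \<le> card X" and x: "x \<in> X"
  shows "\<not> U_reconstructible X {x} T"
proof
  assume rec: "U_reconstructible X {x} T"
  interpret T: phylo X T by fact
  have card4: "4 \<le> card X" using card by simp
  obtain w where w: "w \<notin> verts T" using ex_new_if_finite[OF infinite_UNIV T.finite_verts] by blast
  have cherry: "nbr T y = nbr T x \<and> degree T (nbr T x) = 3" if y: "y \<in> X" "y \<noteq> x" for y
  proof -
    note att = attach_leaf_vertex_deleted[OF T card4 x y(1) y(2)[symmetric] w]
    let ?N = "attach_leaf (vertex_deleted T x) x y w"
    interpret N: phylo X ?N by (rule att(1))
    have "U_reconstruction X {x} T ?N"
      using phylo_network[OF att(1)] att(4) N.X_subset_verts x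
      by (auto simp: U_reconstruction_def equivalent_refl)
    then have "equivalent X ?N T" using rec by (simp add: U_reconstructible_def)
    then show ?thesis
      using equivalent_nbr(1)[OF att(1) T, of x] equivalent_nbr(2)[OF att(1) T, of y x] att(2,3) x y by simp
  qed
  have "card (X - {x}) = card X - 1" using x T.finite_X by simp
  then have "0 < card (X - {x})" using card by simp
  then obtain y where "y \<in> X - {x}" by (rule card_pos_obtains)
  then have y: "y \<in> X" "y \<noteq> x" by auto
  have "card X \<le> degree T (nbr T x)"
    by (rule T.nbr_degree_ge_card) (use cherry in auto)
  then show False using cherry[OF y] card by simp
qed

lemma star_not_reconstructible_from_two:
  fixes T :: "'v::infinite mgraph"
  assumes T: "phylo X T" and card: "5 \<le> card X" and star: "star T" and xy: "x \<in> X" "y \<in> X" "x \<noteq> y"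
  shows "\<not> U_reconstructible X {x, y} T"
proof
  assume rec: "U_reconstructible X {x, y} T"
  interpret T: phylo X T by fact
  have card4: "4 \<le> card X" using card by simp
  obtain w where w: "w \<notin> verts T" using ex_new_if_finite[OF infinite_UNIV T.finite_verts] by blast
  have deg: "5 \<le> degree T (nbr T u)" if "u \<in> X" for u using T.star_degree[OF star that] card by simp
  have deg4: "4 \<le> degree T (nbr T u)" if "u \<in> X" for u using deg[OF that] by simp
  let ?N = "attach_leaf (vertex_deleted T x) x y w"
  note attx = attach_leaf_vertex_deleted[OF T card4 xy w]
  note atty = attach_leaf_vertex_deleted[OF T card4 xy(2,1) xy(3)[symmetric] w]
  interpret N: phylo X ?N by (rule attx(1))
  have "nbr (vertex_deleted T x) y = nbr (vertex_deleted T y) x"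
    using T.nbr_vertex_deleted_high[OF xy(1) deg4[OF xy(1)] xy(2)]
      T.nbr_vertex_deleted_high[OF xy(2) deg4[OF xy(2)] xy(1)] T.star_nbr[OF star xy(1,2)] xy(3) by simp
  moreover have "{#e \<in># edges T. x \<notin> set_uprod e \<and> y \<notin> set_uprod e#}
      = {#e \<in># edges T. y \<notin> set_uprod e \<and> x \<notin> set_uprod e#}"
    by (rule filter_mset_cong) auto
  moreover have "verts T - {x} \<union> {x, w} = verts T - {y} \<union> {y, w}"
    using T.X_subset_verts xy by auto
  ultimately have "?N = attach_leaf (vertex_deleted T y) y x w"
    using T.vertex_deleted_high[OF xy(1) deg4[OF xy(1)]] T.vertex_deleted_high[OF xy(2) deg4[OF xy(2)]]
    by (simp add: attach_leaf_def edges_delete_vertex filter_filter_mset add_mset_commute)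
  then have "vertex_deleted ?N y = vertex_deleted T y" using atty(4) by simp
  then have "U_reconstruction X {x, y} T ?N"
    using phylo_network[OF attx(1)] attx(4) N.X_subset_verts xy
    by (auto simp: U_reconstruction_def equivalent_refl)
  then have "equivalent X ?N T" using rec by (simp add: U_reconstructible_def)
  then show False using equivalent_nbr(1)[OF attx(1) T _ xy(1)] attx(3) deg[OF xy(1)] by simp
qed

lemma U_reconstructible_mono:
  assumes "U_reconstructible X U N" "U \<subseteq> V"
  shows "U_reconstructible X V N"
  using assms by (auto simp: U_reconstructible_def U_reconstruction_def)

lemma U_reconstructible_if_trees:
  assumes T: "phylo X T" and card: "4 \<le> card X" and U: "U \<subseteq> X" "U \<noteq> {}"
    and "\<And>N. phylo X N \<Longrightarrow>
      (\<And>u. u \<in> U \<Longrightarrow> equivalent (X - {u}) (vertex_deleted N u) (vertex_deleted T u)) \<Longrightarrow>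
      equivalent X N T"
  shows "U_reconstructible X U T"
  unfolding U_reconstructible_def
proof (intro allI impI)
  fix N assume rec: "U_reconstruction X U T N"
  obtain u where u: "u \<in> U" "u \<in> X" using U by blast
  have "tree (vertex_deleted T u)" using phylo_vertex_deleted[OF T u(2) card] phylo.is_tree by blast
  then have "phylogenetic_tree X N"
    using network_is_tree[of X N u] rec u by (auto simp: U_reconstruction_def)
  then have "phylo X N" using card by unfold_locales auto
  then show "equivalent X N T" using assms(5) rec by (simp add: U_reconstruction_def)
qed

theorem theorem6p3:
  fixes X :: "'v::infinite set" and T :: "'v mgraph"
  assumes "finite X" and "card X \<ge> 5" and "phylogenetic_tree X T"
  shows "(star T \<longrightarrow> leaf_reconstruction_number X T = 3) \<and>
         (\<not> star T \<longrightarrow> leaf_reconstruction_number X T = 2)"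
proof -
  have card4: "4 \<le> card X" using assms(2) by simp
  have T: "phylo X T" using assms by unfold_locales auto
  interpret T: phylo X T by fact
  have "leaf_reconstruction_number X T = 3" if star: "star T"
    unfolding leaf_reconstruction_number_def
  proof (rule Least_equality)
    obtain U where U: "U \<subseteq> X" "card U = 3" using obtain_subset_with_card_n[of 3 X] assms(2) by auto
    have "U_reconstructible X U T"
      by (rule U_reconstructible_if_trees[OF T card4 U(1)])
        (use U(2) equivalent_star_if_three_deletions[OF _ T assms(2) star U] in auto)
    then show "\<exists>U'\<subseteq>X. card U' = 3 \<and> U_reconstructible X U' T" using U by blast
    fix m assume "\<exists>U'\<subseteq>X. card U' = m \<and> U_reconstructible X U' T"
    then obtain U' where U': "U' \<subseteq> X" "card U' = m" "U_reconstructible X U' T" by blast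
    show "3 \<le> m"
    proof (rule ccontr)
      assume "\<not> 3 \<le> m"
      then obtain V where V: "U' \<subseteq> V" "V \<subseteq> X" "card V = 2"
        using exists_subset_between[of U' 2 X] U' assms(1,2) by auto
      then obtain x y where "V = {x, y}" "x \<noteq> y" by (meson card_2_iff)
      then show False
        using star_not_reconstructible_from_two[OF T assms(2) star, of x y]
          U_reconstructible_mono[OF U'(3) V(1)] V(2) by simp
    qed
  qed
  moreover have "leaf_reconstruction_number X T = 2" if nostar: "\<not> star T"
    unfolding leaf_reconstruction_number_def
  proof (rule Least_equality)
    obtain x x' y y' where xy: "x \<in> X" "x' \<in> X" "y \<in> X" "y' \<in> X" "x \<noteq> x'" "y \<noteq> y'"
      "nbr T x = nbr T x'" "nbr T y = nbr T y'" "nbr T x \<noteq> nbr T y"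
      by (rule T.not_star_two_leaf_pairs[OF nostar])
    have "U_reconstructible X {x, y} T"
    proof (rule U_reconstructible_if_trees[OF T card4])
      fix N assume "phylo X N"
        "\<And>u. u \<in> {x, y} \<Longrightarrow> equivalent (X - {u}) (vertex_deleted N u) (vertex_deleted T u)"
      then show "equivalent X N T"
        using equivalent_if_two_deletions[OF _ T assms(2) xy] by blast
    qed (use xy in auto)
    moreover have "card {x, y} = 2" using xy(9) by (auto simp: card_insert_if)
    ultimately show "\<exists>U'\<subseteq>X. card U' = 2 \<and> U_reconstructible X U' T"
      using xy by (intro exI[of _ "{x, y}"]) auto
    fix m assume "\<exists>U'\<subseteq>X. card U' = m \<and> U_reconstructible X U' T"
    then obtain U' where U': "U' \<subseteq> X" "card U' = m" "U_reconstructible X U' T" by blast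
    show "2 \<le> m"
    proof (rule ccontr)
      assume "\<not> 2 \<le> m"
      then obtain V where V: "U' \<subseteq> V" "V \<subseteq> X" "card V = 1"
        using exists_subset_between[of U' 1 X] U' assms(1,2) by auto
      then obtain v where "V = {v}" by (meson card_1_singletonE)
      then show False
        using not_reconstructible_from_one[OF T assms(2), of v]
          U_reconstructible_mono[OF U'(3) V(1)] V(2) by simp
    qed
  qed
  ultimately show ?thesis by blast
qed

end
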